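(* Let $c>0$, $a>0$, $b\in(0,1)$, $\gamma\in[0,1)$, and $\alpha>0$ with $\alpha\ne1$, $2-\alpha-\gamma\ne0$. For each $N\ge1$ consider $N$ homogeneous G-AIMD users ($\gamma_k=\gamma$, $a_k=a$, $b_k=b$ for $k=1,\dots,N$) with capacity $cN$, and let $u_{ind}$, $u^*$, $J(u,x,cN,N)$ and the steady state $\tilde x^*(cN)\in(0,\infty)^N$ be as in the context. Then, if the initial state is close enough to the steady state, the index policy is asymptotically optimal for the problem with hard capacity constraint. That is, there exist $\varepsilon_N>0$ ($N\ge1$) such that for all initial states $x=x^{(N)}\in(0,\infty)^N$ with $\|x^{(N)}-\tilde x^*(cN)\|<\varepsilon_N$ for every $N$, $$\lim_{N\to\infty}\frac1NJ(u_{ind},x,cN,N)=\lim_{N\to\infty}\frac1NJ(u^*,x,cN,N).$$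
   Context: Dynamics. For $N$ users, $x_k(t)>0$ is the rate of user $k$. Between impulses $\frac{dx_k}{dt}=ax_k^\gamma$; when an impulse is applied to user $k$ at time $t$, $x_k(t+0)=bx_k(t)$. The initial state is $x(0)=x\in(0,\infty)^N$. Criterion. For a policy $u$ (a rule determining the impulse times of all users), with $N$ users, capacity $C$ and initial state $x$, $$J(u,x,C,N)=\sum_{k=1}^N\liminf_{\tau\to\infty}\frac1\tau\int_0^\tau\frac{x_k^{1-\alpha}(t)}{1-\alpha}\,dt.$$ (The capacity $C$ enters through the policy.) The hard capacity constraint is $\sum_{k=1}^Nx_k(t)\le C$ for all $t$. Index policy $u_{ind}$. Let $\lambda(x)=\frac{(2-\gamma)(1-b^{2-\alpha-\gamma})}{(1-b^{2-\gamma})(2-\alpha-\gamma)}x^{-\alpha}$, $x>0$ (a decreasing function). Whenever the hard constraint is reached ($\sum_kx_k(t)\ge C$), the user with the minimal value of $\lambda(x_k(t))$, equivalently with the maximal rate $x_k(t)$, receives an impulse (ties broken by any fixed rule; at the initial time this is repeated if necessary until the sum is below $C$). Threshold policy $u^*$. Each user $k$ receives an impulse at time $t$ as soon as $x_k(t)\ge\bar x$, where $$\bar x=\frac CN\,\frac{1-b^{1-\gamma}}{1-\gamma}\,\frac{2-\gamma}{1-b^{2-\gamma}}.$$ This is the policy that is optimal for maximizing $\sum_k\liminf_\tau\frac1\tau E\int_0^\tau\frac{x_k^{1-\alpha}(t)}{1-\alpha}dt$ under the relaxed constraint $\sum_k\limsup_\tau\frac1\tau E\int_0^\tau x_k(t)dt\le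 C$. In the claim $C=cN$. Steady state. $\tilde x^*(C)=(\tilde x_1^*,\dots,\tilde x_N^* )$ is the fixed point of the map sending the decreasingly ordered vector of rates at an instant when the sum reaches $C$ (just before the reduction of the largest rate) to the corresponding ordered vector at the next such instant; explicitly $$\tilde x_1^*=\frac{C}{\sum_{i=1}^N\left(b^{1-\gamma}+\frac iN(1-b^{1-\gamma})\right)^{\frac1{1-\gamma}}},\qquad \tilde x_n^*=\tilde x_1^*\left[b^{1-\gamma}+\frac{N-n+1}{N}(1-b^{1-\gamma})\right]^{\frac1{1-\gamma}},\ 2\le n\le N.$$ *)

theory Defs
  imports "HOL-Analysis.Analysis"
begin

text \<open>Users are numbered \<open>1, \<dots>, N\<close>; a state is a function on \<open>nat\<close> of which only the coordinates
  in \<open>{1..N}\<close> are meaningful.\<close>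

type_synonym state = "nat \<Rightarrow> real"

text \<open>A policy is a feedback rule: given the capacity, the number of users and the current state,
  it names the users that receive an impulse at once.  The set is empty if no impulse is due.\<close>

type_synonym policy = "real \<Rightarrow> nat \<Rightarrow> state \<Rightarrow> nat set"

definition impulse :: "real \<Rightarrow> nat set \<Rightarrow> state \<Rightarrow> state" where
  "impulse b S x = (\<lambda>k. if k \<in> S then b * x k else x k)"

text \<open>The state just after an instant at which the state is \<open>x\<close>: the rule \<open>u\<close> is applied repeatedly
  until it calls for no further impulse.  More than one round can be needed only at time \<open>0\<close>, when the
  initial state is beyond the constraint or threshold.  If no impulse is due the state is unchanged.\<close>

definition post_state :: "real \<Rightarrow> (state \<Rightarrow> nat set) \<Rightarrow> state \<Rightarrow> state" where
  "post_state b u x =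
     (let F = (\<lambda>y. impulse b (u y) y) in (F ^^ (LEAST n. u ((F ^^ n) x) = {})) x)"

definition impulse_times :: "(state \<Rightarrow> nat set) \<Rightarrow> (real \<Rightarrow> state) \<Rightarrow> real set" where
  "impulse_times u X = {t. 0 \<le> t \<and> u (X t) \<noteq> {}}"

text \<open>Trajectories are left-continuous: \<open>X t\<close> is the state before the impulses at time \<open>t\<close> and the
  right limit at \<open>t\<close> is the state after them.  Coordinates outside \<open>{1..N}\<close> are set to \<open>0\<close>, so that
  the closed loop is determined by the initial rates even if \<open>u\<close> inspects the whole function.\<close>

definition is_trajectory ::
    "real \<Rightarrow> real \<Rightarrow> real \<Rightarrow> (state \<Rightarrow> nat set) \<Rightarrow> nat \<Rightarrow> state \<Rightarrow> (real \<Rightarrow> state) \<Rightarrow> bool" where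
  "is_trajectory a b \<gamma> u N x X \<longleftrightarrow>
     (\<forall>k\<in>{1..N}. X 0 k = x k) \<and>
     (\<forall>t\<ge>0. \<forall>k. k \<notin> {1..N} \<longrightarrow> X t k = 0) \<and>
     (\<forall>t\<ge>0. \<forall>k\<in>{1..N}. 0 < X t k) \<and>
     (\<forall>\<tau>. finite (impulse_times u X \<inter> {0..\<tau>})) \<and>
     (\<forall>t>0. t \<notin> impulse_times u X \<longrightarrow>
        (\<forall>k\<in>{1..N}. ((\<lambda>s. X s k) has_real_derivative a * X t k powr \<gamma>) (at t))) \<and>
     (\<forall>t>0. \<forall>k\<in>{1..N}. ((\<lambda>s. X s k) \<longlongrightarrow> X t k) (at_left t)) \<and>
     (\<forall>t\<ge>0. \<forall>k\<in>{1..N}. ((\<lambda>s. X s k) \<longlongrightarrow> post_state b u (X t) k) (at_right t))"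

definition trajectory ::
    "real \<Rightarrow> real \<Rightarrow> real \<Rightarrow> (state \<Rightarrow> nat set) \<Rightarrow> nat \<Rightarrow> state \<Rightarrow> real \<Rightarrow> state" where
  "trajectory a b \<gamma> u N x = (SOME X. is_trajectory a b \<gamma> u N x X)"

definition J ::
    "real \<Rightarrow> real \<Rightarrow> real \<Rightarrow> real \<Rightarrow> policy \<Rightarrow> state \<Rightarrow> real \<Rightarrow> nat \<Rightarrow> ereal" where
  "J a b \<gamma> \<alpha> u x C N =
     (\<Sum>k=1..N. Liminf at_top (\<lambda>\<tau>.
        ereal (1 / \<tau> * integral {0..\<tau>}
          (\<lambda>t. trajectory a b \<gamma> (u C N) N x t k powr (1 - \<alpha>) / (1 - \<alpha>)))))"

definition index_fun :: "real \<Rightarrow> real \<Rightarrow> real \<Rightarrow> real \<Rightarrow> real" where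
  "index_fun b \<gamma> \<alpha> x =
     ((2 - \<gamma>) * (1 - b powr (2 - \<alpha> - \<gamma>))) / ((1 - b powr (2 - \<gamma>)) * (2 - \<alpha> - \<gamma>)) * x powr (- \<alpha>)"

text \<open>The argument \<open>tie N x\<close> is the tie-breaking rule; it selects one of the users of minimal index.\<close>

definition index_policy ::
    "real \<Rightarrow> real \<Rightarrow> real \<Rightarrow> (nat \<Rightarrow> state \<Rightarrow> nat set \<Rightarrow> nat) \<Rightarrow> policy" where
  "index_policy b \<gamma> \<alpha> tie C N x =
     (if (\<Sum>k=1..N. x k) \<ge> C
      then {tie N x {k. is_arg_min (\<lambda>k. index_fun b \<gamma> \<alpha> (x k)) (\<lambda>k. k \<in> {1..N}) k}}
      else {})"

definition threshold :: "real \<Rightarrow> real \<Rightarrow> real \<Rightarrow> nat \<Rightarrow> real" where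
  "threshold b \<gamma> C N =
     C / real N * ((1 - b powr (1 - \<gamma>)) / (1 - \<gamma>)) * ((2 - \<gamma>) / (1 - b powr (2 - \<gamma>)))"

definition threshold_policy :: "real \<Rightarrow> real \<Rightarrow> policy" where
  "threshold_policy b \<gamma> C N x = {k \<in> {1..N}. x k \<ge> threshold b \<gamma> C N}"

definition steady_max :: "real \<Rightarrow> real \<Rightarrow> real \<Rightarrow> nat \<Rightarrow> real" where
  "steady_max b \<gamma> C N =
     C / (\<Sum>i=1..N. (b powr (1 - \<gamma>) + real i / real N * (1 - b powr (1 - \<gamma>))) powr (1 / (1 - \<gamma>)))"

definition steady_state :: "real \<Rightarrow> real \<Rightarrow> real \<Rightarrow> nat \<Rightarrow> state" where
  "steady_state b \<gamma> C N n =
     (if n = 1 then steady_max b \<gamma> C N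
      else steady_max b \<gamma> C N *
        (b powr (1 - \<gamma>) + real (N - n + 1) / real N * (1 - b powr (1 - \<gamma>))) powr (1 / (1 - \<gamma>)))"

end

theory Submission
  imports Defs
begin

text \<open>In the coordinates \<open>y = x powr (1 - \<gamma>)\<close> all rates grow at the common speed \<open>(1 - \<gamma>) * a\<close> and an
  impulse multiplies \<open>y\<close> by \<open>b powr (1 - \<gamma>)\<close>.  There is a function \<open>H\<close> of the rate whose derivative along
  the flow is the reward minus a constant \<open>L\<close>.  An impulse at a rate \<open>M\<close> changes \<open>H\<close> by the
  induced decrease of \<open>y\<close>, up to scaling, times \<open>L\<close> minus the average reward of a cycle from \<open>b * M\<close> to \<open>M\<close>.
  Hence a user whose impulses all occur at rates for which that average is within \<open>\<kappa>\<close> of \<open>L\<close> has a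
  long-run average within \<open>\<kappa>\<close> of \<open>L\<close>.  Under the threshold policy all impulses occur at the threshold, so
  \<open>\<kappa> = 0\<close> for the corresponding \<open>L\<close>.  Under the index policy the range of the deviations of the ordered
  \<open>y\<close>-vector from the steady state never widens, so near the steady state all impulses occur
  close to \<open>steady_max\<close>, which tends to the threshold by a Riemann sum.\<close>

subsection \<open>Trajectories between impulses\<close>

text \<open>Vanishing off \<open>{1..N}\<close> matches \<open>is_trajectory\<close>; states can
  then be compared as whole functions, which matters since a rule may inspect every
  coordinate.\<close>

definition adm :: "nat \<Rightarrow> state \<Rightarrow> bool" where
  "adm N z \<longleftrightarrow> (\<forall>k\<in>{1..N}. 0 < z k) \<and> (\<forall>k. k \<notin> {1..N} \<longrightarrow> z k = 0)"

lemma adm_pos: "adm N z \<Longrightarrow> k \<in> {1..N} \<Longrightarrow> 0 < z k"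
  and adm_zero: "adm N z \<Longrightarrow> k \<notin> {1..N} \<Longrightarrow> z k = 0"
  by (auto simp: adm_def)

locale gaimd =
  fixes a b \<gamma> :: real and N :: nat
  assumes a: "0 < a" and b: "0 < b" "b < 1" and g: "\<gamma> < 1"
begin

text \<open>The closed-form solution of the growth equation started at \<open>z\<close>: each
  \<open>x powr (1 - \<gamma>)\<close> increases linearly.\<close>

definition flow :: "state \<Rightarrow> real \<Rightarrow> state" where
  "flow z s k = (if k \<in> {1..N} then (z k powr (1 - \<gamma>) + (1 - \<gamma>) * a * s) powr (1 / (1 - \<gamma>)) else 0)"

lemma rate_pos: "0 < (1 - \<gamma>) * a"
  using a g by simp

lemma bpow: "0 < b powr (1 - \<gamma>)" "b powr (1 - \<gamma>) < 1"
  using b g powr_less_mono2[of "1 - \<gamma>" b 1] by auto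

lemma flow_base_pos: "adm N z \<Longrightarrow> 0 \<le> s \<Longrightarrow> k \<in> {1..N} \<Longrightarrow> 0 < z k powr (1 - \<gamma>) + (1 - \<gamma>) * a * s"
  using adm_pos[of N z k] rate_pos by (intro add_pos_nonneg) auto

lemma flow_powr: "adm N z \<Longrightarrow> 0 \<le> s \<Longrightarrow> k \<in> {1..N} \<Longrightarrow>
    flow z s k powr (1 - \<gamma>) = z k powr (1 - \<gamma>) + (1 - \<gamma>) * a * s"
  using flow_base_pos[of z s k] g by (simp add: flow_def powr_powr)

lemma powr_root: "0 < x \<Longrightarrow> (x powr (1 - \<gamma>)) powr (1 / (1 - \<gamma>)) = x"
  using g by (simp add: powr_powr)

lemma flow_0: "adm N z \<Longrightarrow> flow z 0 = z"
  using g by (auto simp: flow_def adm_zero powr_root adm_pos fun_eq_iff)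

lemma flow_adm: "adm N z \<Longrightarrow> 0 \<le> s \<Longrightarrow> adm N (flow z s)"
  using flow_base_pos[of z s] by (auto simp: adm_def[of N "flow z s"] flow_def less_imp_neq[symmetric])

lemma flow_deriv:
  assumes "adm N z" "0 \<le> s" "k \<in> {1..N}"
  shows "((\<lambda>s. flow z s k) has_real_derivative a * flow z s k powr \<gamma>) (at s)"
proof -
  let ?B = "\<lambda>s. z k powr (1 - \<gamma>) + (1 - \<gamma>) * a * s"
  have pos: "?B s > 0" using flow_base_pos assms by blast
  have "((\<lambda>s. ?B s powr (1 / (1 - \<gamma>))) has_real_derivative
      (1 / (1 - \<gamma>) * ?B s powr (1 / (1 - \<gamma>) - 1)) * ((1 - \<gamma>) * a)) (at s)"
    by (rule DERIV_chain2[where f = "\<lambda>x. x powr (1 / (1 - \<gamma>))" and g = ?B])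
      (auto intro!: derivative_eq_intros has_real_derivative_powr pos)
  also have "(1 / (1 - \<gamma>) * ?B s powr (1 / (1 - \<gamma>) - 1)) * ((1 - \<gamma>) * a) = a * flow z s k powr \<gamma>"
  proof -
    have "1 / (1 - \<gamma>) - 1 = 1 / (1 - \<gamma>) * \<gamma>" using g by (simp add: field_simps)
    then show ?thesis using assms g by (simp add: flow_def powr_powr)
  qed
  finally show ?thesis using assms by (simp add: flow_def)
qed

lemma flow_isCont: "adm N z \<Longrightarrow> 0 \<le> s \<Longrightarrow> isCont (\<lambda>s. flow z s k) s"
  using flow_deriv[THEN DERIV_isCont, of z s k]
  by (cases "k \<in> {1..N}") (auto simp: flow_def)

text \<open>Impulses lower \<open>x k\<close>; since \<open>x k powr (1 - \<gamma>)\<close> grows at a constant speed,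
  the sum of these powers bounds the number of impulses.\<close>

definition pot :: "state \<Rightarrow> real" where
  "pot z = (\<Sum>k=1..N. z k powr (1 - \<gamma>))"

lemma pot_nonneg: "0 \<le> pot z"
  by (simp add: pot_def sum_nonneg)

lemma pot_mono: "adm N y \<Longrightarrow> \<forall>k. y k \<le> z k \<Longrightarrow> pot y \<le> pot z"
  unfolding pot_def using g adm_pos by (intro sum_mono powr_mono2) (auto intro: less_imp_le)

lemma pot_flow: "adm N z \<Longrightarrow> 0 \<le> s \<Longrightarrow> pot (flow z s) = pot z + real N * ((1 - \<gamma>) * a * s)"
  unfolding pot_def by (simp add: flow_powr sum.distrib)

abbreviation imp :: "(state \<Rightarrow> nat set) \<Rightarrow> state \<Rightarrow> state" where
  "imp u \<equiv> (\<lambda>y. impulse b (u y) y)"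

lemma imp_adm: "adm N z \<Longrightarrow> adm N (impulse b S z)"
  using b by (auto simp: adm_def impulse_def)

lemma imp_pow_adm: "adm N z \<Longrightarrow> adm N ((imp u ^^ n) z)"
  by (induction n) (auto intro: imp_adm)

lemma imp_le: "adm N z \<Longrightarrow> impulse b S z k \<le> z k"
  using b adm_pos[of N z k] adm_zero[of N z k]
  by (cases "k \<in> {1..N}") (auto simp: impulse_def mult_le_cancel_right1)

lemma imp_pow_le: "adm N z \<Longrightarrow> (imp u ^^ n) z k \<le> z k"
proof (induction n)
  case (Suc n)
  then show ?case using imp_le[OF imp_pow_adm[where u = u and n = n], of z "u ((imp u ^^ n) z)" k] by simp
qed simp

lemma post_state_eq: "post_state b u x = (imp u ^^ (LEAST n. u ((imp u ^^ n) x) = {})) x"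
  by (simp add: post_state_def Let_def)

lemma post_adm: "adm N z \<Longrightarrow> adm N (post_state b u z)"
  unfolding post_state_eq by (rule imp_pow_adm)

lemma post_none: "u z = {} \<Longrightarrow> post_state b u z = z"
  unfolding post_state_eq by (subst Least_eq_0) auto

lemma post_one: "u z \<noteq> {} \<Longrightarrow> u (impulse b (u z) z) = {} \<Longrightarrow> post_state b u z = impulse b (u z) z"
proof -
  assume *: "u z \<noteq> {}" "u (impulse b (u z) z) = {}"
  have "(LEAST n. u ((imp u ^^ n) z) = {}) = 1"
  proof (rule Least_equality)
    show "1 \<le> n" if "u ((imp u ^^ n) z) = {}" for n
      using that *(1) by (cases n) auto
  qed (use * in auto)
  then show ?thesis unfolding post_state_eq by simp
qed

lemma traj_adm: "is_trajectory a b \<gamma> u N x X \<Longrightarrow> 0 \<le> t \<Longrightarrow> adm N (X t)"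
  unfolding is_trajectory_def adm_def by auto

text \<open>Uniqueness for the growth equation:
  \<open>X s k powr (1 - \<gamma>) - (1 - \<gamma>) * a * s\<close> has derivative 0 while no
  impulse occurs, and its constant value is identified by the left limit at \<open>t\<close> and the
  right limit at \<open>t'\<close>.\<close>

lemma traj_flow:
  assumes X: "is_trajectory a b \<gamma> u N x X" and t: "0 \<le> t'" "t' < t"
    and no: "\<forall>s\<in>{t'<..<t}. u (X s) = {}"
  shows "X t = flow (post_state b u (X t')) (t - t')"
proof
  fix k
  show "X t k = flow (post_state b u (X t')) (t - t') k"
  proof (cases "k \<in> {1..N}")
    case False
    then show ?thesis using traj_adm[OF X, of t] t by (auto simp: flow_def dest!: adm_zero)
  next
    case k: True
    define z where "z = post_state b u (X t')"
    have z: "adm N z" unfolding z_def using traj_adm[OF X, of t'] t by (intro post_adm) auto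
    define D where "D = (\<lambda>s. X s k powr (1 - \<gamma>) - (1 - \<gamma>) * a * s)"
    have pos: "0 < X s k" if "0 \<le> s" for s using traj_adm[OF X that] k by (auto dest: adm_pos)
    have der: "(D has_real_derivative 0) (at s)" if s: "s \<in> {t'<..<t}" for s
    proof -
      have s0: "0 < s" using s t by auto
      have "s \<notin> impulse_times u X" using no s by (auto simp: impulse_times_def)
      then have d: "((\<lambda>s. X s k) has_real_derivative a * X s k powr \<gamma>) (at s)"
        using X k s0 unfolding is_trajectory_def by blast
      have p: "0 < X s k" using pos[of s] s0 by simp
      have "((\<lambda>s. X s k powr (1 - \<gamma>)) has_real_derivative
          ((1 - \<gamma>) * X s k powr ((1 - \<gamma>) - 1)) * (a * X s k powr \<gamma>)) (at s)"
        by (rule DERIV_chain2[where f = "\<lambda>x. x powr (1 - \<gamma>)", OF has_real_derivative_powr[OF p] d])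
      moreover have "((1 - \<gamma>) * X s k powr ((1 - \<gamma>) - 1)) * (a * X s k powr \<gamma>) = (1 - \<gamma>) * a"
        using p by (simp add: powr_minus field_simps)
      ultimately have "((\<lambda>s. X s k powr (1 - \<gamma>)) has_real_derivative (1 - \<gamma>) * a) (at s)"
        by (simp only:)
      moreover have "((\<lambda>s. (1 - \<gamma>) * a * s) has_real_derivative (1 - \<gamma>) * a) (at s)"
        by (auto intro!: derivative_eq_intros)
      ultimately show ?thesis
        using DERIV_diff[of _ "(1 - \<gamma>) * a" s UNIV "\<lambda>s. (1 - \<gamma>) * a * s"] unfolding D_def by fastforce
    qed
    have left: "(D \<longlongrightarrow> D t) (at_left t)"
    proof -
      have "((\<lambda>s. X s k) \<longlongrightarrow> X t k) (at_left t)"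
        using X k t unfolding is_trajectory_def by auto
      then show ?thesis unfolding D_def using pos[of t] t by (auto intro!: tendsto_intros)
    qed
    \<comment> \<open>The derivative is controlled only on the open interval; left continuity lets
      the argument include the end point \<open>t\<close>, where an impulse may occur.\<close>
    have const: "D s = D t" if s: "s \<in> {t'<..<t}" for s
    proof -
      have "continuous_on {s..t} D"
      proof (rule continuous_on_eq_continuous_within[THEN iffD2], safe)
        fix y assume y: "y \<in> {s..t}"
        show "continuous (at y within {s..t}) D"
        proof (cases "y = t")
          case True
          have "at t within {s..t} = at_left t"
            using s by (intro at_within_Icc_at_left) auto
          then show ?thesis using left True by (simp add: continuous_within)
        next
          case False
          then have "isCont D y" using y s by (intro DERIV_isCont[OF der]) auto
          then show ?thesis by (rule continuous_at_imp_continuous_within)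
        qed
      qed
      then show ?thesis using DERIV_isconst_end[of s t D] der s by auto
    qed
    have lim: "(D \<longlongrightarrow> z k powr (1 - \<gamma>) - (1 - \<gamma>) * a * t') (at_right t')"
    proof -
      have "((\<lambda>s. X s k) \<longlongrightarrow> z k) (at_right t')"
        using X k t unfolding is_trajectory_def z_def by auto
      then show ?thesis unfolding D_def using adm_pos[OF z k] by (auto intro!: tendsto_intros)
    qed
    have "\<forall>\<^sub>F s in at_right t'. D s = D t"
      using const t(2) by (rule eventually_at_rightI)
    then have "(D \<longlongrightarrow> D t) (at_right t')"
      by (rule tendsto_eventually)
    with lim have "D t = z k powr (1 - \<gamma>) - (1 - \<gamma>) * a * t'"
      by (intro tendsto_unique[OF _ _ lim]) (auto simp: trivial_limit_at_right_real)
    then have "X t k powr (1 - \<gamma>) = z k powr (1 - \<gamma>) + (1 - \<gamma>) * a * (t - t')"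
      by (simp add: D_def algebra_simps)
    then have "(X t k powr (1 - \<gamma>)) powr (1 / (1 - \<gamma>)) = flow z (t - t') k"
      using k by (simp add: flow_def)
    then show ?thesis using powr_root[OF pos[of t]] t by (simp add: z_def)
  qed
qed

text \<open>Induction along the impulse times, which are finite in number on bounded intervals.
  \<open>P\<close> is carried from one impulse time to the next and on to \<open>t\<close>; time 0
  is a separate start, at which neither \<open>P\<close> nor an impulse is available.\<close>

lemma traj_induct:
  assumes X: "is_trajectory a b \<gamma> u N x X" and "0 < t"
    and step: "\<And>t' t. 0 \<le> t' \<Longrightarrow> t' < t \<Longrightarrow> t' = 0 \<or> P t' \<and> u (X t') \<noteq> {} \<Longrightarrow>
      (\<And>s. t' < s \<Longrightarrow> s \<le> t \<Longrightarrow> X s = flow (post_state b u (X t')) (s - t')) \<Longrightarrow>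
      (\<And>s. t' < s \<Longrightarrow> s < t \<Longrightarrow> u (X s) = {}) \<Longrightarrow> P t"
  shows "P t"
  using \<open>0 < t\<close>
proof (induction "card (impulse_times u X \<inter> {0<..<t})" arbitrary: t rule: less_induct)
  case less
  define A where "A = impulse_times u X \<inter> {0<..<t}"
  have "finite (impulse_times u X \<inter> {0..t})"
    using X unfolding is_trajectory_def by simp
  then have fin: "finite A"
    by (rule finite_subset[rotated]) (auto simp: A_def)
  \<comment> \<open>The last impulse time strictly between 0 and \<open>t\<close>, or 0 if there is
    none. Fewer impulse times precede it, so the induction hypothesis yields
    \<open>P t'\<close>.\<close>
  define t' where "t' = (if A = {} then 0 else Max A)"
  have t'A: "t' = 0 \<or> t' \<in> A"
    using Max_in[OF fin] by (auto simp: t'_def)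
  then have t': "0 \<le> t'" "t' < t" "t' = 0 \<or> t' \<in> A"
    using less.prems by (auto simp: A_def)
  have no: "u (X s) = {}" if "t' < s" "s < t" for s
  proof (rule ccontr)
    assume "u (X s) \<noteq> {}"
    then have "s \<in> A" using that t' by (auto simp: A_def impulse_times_def)
    then have "s \<le> t'" using Max_ge[OF fin] by (auto simp: t'_def)
    with that show False by simp
  qed
  show ?case
  proof (rule step[OF t'(1,2) _ _ no])
    show "t' = 0 \<or> P t' \<and> u (X t') \<noteq> {}"
    proof (cases "t' = 0")
      case False
      then have A: "t' \<in> A" using t' by auto
      have "impulse_times u X \<inter> {0<..<t'} \<subset> A" using A t' by (auto simp: A_def)
      then have "P t'"
        using less.hyps[of t'] psubset_card_mono[OF fin] False t' by (auto simp: A_def)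
      then show ?thesis using A by (auto simp: A_def impulse_times_def)
    qed simp
    show "X s = flow (post_state b u (X t')) (s - t')" if "t' < s" "s \<le> t" for s
      using that t' no by (intro traj_flow[OF X]) auto
  qed
qed

end

subsection \<open>Existence of trajectories\<close>

text \<open>What existence of trajectories asks of a rule: \<open>big\<close> makes every round of
  impulses cost a fixed amount of \<open>pot\<close>, which excludes accumulation, and
  \<open>hits\<close> provides a first impulse time that is positive and attained.\<close>

locale gaimd_policy = gaimd +
  fixes u :: "state \<Rightarrow> nat set" and \<mu> :: real
  assumes mu: "0 < \<mu>"
    and big: "\<And>z. adm N z \<Longrightarrow> u z \<noteq> {} \<Longrightarrow> \<exists>k\<in>u z \<inter> {1..N}. \<mu> \<le> z k"
    and hits: "\<And>z. adm N z \<Longrightarrow> u z = {} \<Longrightarrow>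
      \<exists>S>0. u (flow z S) \<noteq> {} \<and> (\<forall>s. 0 \<le> s \<longrightarrow> s < S \<longrightarrow> u (flow z s) = {})"
begin

definition min_drop :: real where
  "min_drop = (1 - b powr (1 - \<gamma>)) * \<mu> powr (1 - \<gamma>)"

lemma min_drop_pos: "0 < min_drop"
  using bpow mu by (simp add: min_drop_def)

text \<open>A user with rate at least \<mu> loses the fraction
  \<open>1 - b powr (1 - \<gamma>)\<close> of its term, hence at least \<open>min_drop\<close>; no
  other term grows.\<close>

lemma pot_imp:
  assumes z: "adm N z" "u z \<noteq> {}"
  shows "pot (imp u z) \<le> pot z - min_drop"
proof -
  obtain k where k: "k \<in> u z" "k \<in> {1..N}" "\<mu> \<le> z k"
    using big[OF z] by auto
  have le: "imp u z i powr (1 - \<gamma>) \<le> z i powr (1 - \<gamma>) - (if i = k then min_drop else 0)"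
    if i: "i \<in> {1..N}" for i
  proof (cases "i = k")
    case True
    have "\<mu> powr (1 - \<gamma>) \<le> z k powr (1 - \<gamma>)"
      using k mu g by (intro powr_mono2) auto
    then have "min_drop \<le> (1 - b powr (1 - \<gamma>)) * z k powr (1 - \<gamma>)"
      unfolding min_drop_def using bpow by (intro mult_left_mono) auto
    moreover have "imp u z i powr (1 - \<gamma>) = b powr (1 - \<gamma>) * z k powr (1 - \<gamma>)"
      using True k b by (simp add: impulse_def powr_mult)
    ultimately show ?thesis using True by (simp add: algebra_simps)
  next
    case False
    then show ?thesis
      using imp_le[OF z(1), of "u z" i] adm_pos[OF imp_adm[OF z(1), of "u z"] i] g
      by (auto intro!: powr_mono2)
  qed
  have "pot (imp u z) \<le> (\<Sum>i=1..N. z i powr (1 - \<gamma>) - (if i = k then min_drop else 0))"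
    unfolding pot_def using le by (intro sum_mono) auto
  also have "\<dots> = pot z - min_drop"
    using k by (simp add: sum_subtractf pot_def)
  finally show ?thesis .
qed

text \<open>Infinitely many rounds would drive the nonnegative \<open>pot\<close> below
  zero.\<close>

lemma post_terminates:
  assumes "adm N z"
  shows "\<exists>n. u ((imp u ^^ n) z) = {}"
proof (rule ccontr)
  assume *: "\<nexists>n. u ((imp u ^^ n) z) = {}"
  have "pot ((imp u ^^ n) z) \<le> pot z - real n * min_drop" for n
  proof (induction n)
    case (Suc n)
    show ?case
      using Suc pot_imp[OF imp_pow_adm[OF assms, where u = u and n = n]] * by (simp add: algebra_simps)
  qed simp
  then have "real n * min_drop \<le> pot z" for n
    by (meson diff_ge_0_iff_ge order_trans pot_nonneg)
  moreover obtain n where "pot z < real n * min_drop"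
    using reals_Archimedean3[OF min_drop_pos] by blast
  ultimately show False by (meson not_less)
qed

lemma u_post: "adm N z \<Longrightarrow> u (post_state b u z) = {}"
  unfolding post_state_eq using LeastI_ex[OF post_terminates] .

lemma pot_post:
  assumes z: "adm N z" "u z \<noteq> {}"
  shows "pot (post_state b u z) \<le> pot z - min_drop"
proof -
  define n where "n = (LEAST n. u ((imp u ^^ n) z) = {})"
  have "u ((imp u ^^ n) z) = {}"
    unfolding n_def using LeastI_ex[OF post_terminates[OF z(1)]] .
  then obtain m where n: "n = Suc m" using z by (cases n) auto
  \<comment> \<open>The first round is split off: it alone pays \<open>min_drop\<close>, and the
    remaining rounds only lower rates.\<close>
  have "post_state b u z = (imp u ^^ m) (imp u z)"
    unfolding post_state_eq n_def[symmetric] n by (simp only: funpow_Suc_right o_apply)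
  then have "pot (post_state b u z) \<le> pot (imp u z)"
    using imp_pow_le[OF imp_adm[OF z(1)]] imp_pow_adm[OF imp_adm[OF z(1)]]
    by (intro pot_mono) auto
  then show ?thesis using pot_imp[OF z] by simp
qed

definition hit :: "state \<Rightarrow> real" where
  "hit z = (SOME S. 0 < S \<and> u (flow z S) \<noteq> {} \<and> (\<forall>s. 0 \<le> s \<longrightarrow> s < S \<longrightarrow> u (flow z s) = {}))"

lemma hit:
  assumes "adm N z" "u z = {}"
  shows "0 < hit z" "u (flow z (hit z)) \<noteq> {}" "\<And>s. 0 \<le> s \<Longrightarrow> s < hit z \<Longrightarrow> u (flow z s) = {}"
  using someI_ex[OF hits[OF assms]] unfolding hit_def[symmetric] by auto

text \<open>Flow segments are glued at successive first hitting times. They cover all times because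
  \<open>pot\<close> limits the number of impulses in bounded time.\<close>

lemma ex_trajectory:
  assumes x: "\<And>k. k \<in> {1..N} \<Longrightarrow> 0 < x k"
  shows "\<exists>X. is_trajectory a b \<gamma> u N x X"
proof -
  define x0 where "x0 = (\<lambda>k. if k \<in> {1..N} then x k else 0)"
  have x0: "adm N x0" using x by (auto simp: adm_def x0_def)
  \<comment> \<open>\<open>Z j\<close> is the state at the start of segment \<open>j\<close>, after
    the impulses, and \<open>T j\<close> its starting time; \<open>Z 0\<close> has already undergone
    the initial impulses.\<close>
  define Z where "Z j = ((\<lambda>z. post_state b u (flow z (hit z))) ^^ j) (post_state b u x0)" for j
  define T where "T j = (\<Sum>i<j. hit (Z i))" for j
  have Z0: "Z 0 = post_state b u x0" and ZS: "Z (Suc j) = post_state b u (flow (Z j) (hit (Z j)))" for j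
    by (auto simp: Z_def)
  have T0: "T 0 = 0" and TS: "T (Suc j) = T j + hit (Z j)" for j by (auto simp: T_def)
  have Z: "adm N (Z j) \<and> u (Z j) = {}" for j
  proof (induction j)
    case 0
    then show ?case using x0 by (auto simp: Z0 post_adm u_post)
  next
    case (Suc j)
    then have "adm N (flow (Z j) (hit (Z j)))"
      using hit(1)[of "Z j"] by (intro flow_adm) auto
    then show ?case by (auto simp: ZS post_adm u_post)
  qed
  note hitZ = hit[OF Z[THEN conjunct1] Z[THEN conjunct2]]
  have Tless: "T i < T j" if "i < j" for i j
    by (rule lift_Suc_mono_less[OF _ that]) (simp add: TS hitZ(1))
  have Tle: "T i \<le> T j" if "i \<le> j" for i j
    using that Tless[of i j] by (cases "i = j") auto
  have T_nonneg: "0 \<le> T j" for j using Tle[of 0 j] T0 by simp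
  \<comment> \<open>Balance of \<open>pot\<close>: growth adds a constant amount per unit of time,
    and each of the \<open>j\<close> impulse instants removes at least
    \<open>min_drop\<close>.\<close>
  have potZ: "pot (Z j) + real j * min_drop \<le> pot (Z 0) + real N * ((1 - \<gamma>) * a * T j)" for j
  proof (induction j)
    case (Suc j)
    have "pot (Z (Suc j)) \<le> pot (flow (Z j) (hit (Z j))) - min_drop"
      unfolding ZS using hitZ(1,2)[of j] Z by (intro pot_post flow_adm) auto
    also have "pot (flow (Z j) (hit (Z j))) = pot (Z j) + real N * ((1 - \<gamma>) * a * hit (Z j))"
      using hitZ(1)[of j] Z by (intro pot_flow) auto
    finally show ?case using Suc by (simp add: TS algebra_simps)
  qed (simp add: T0)
  have unb: "\<exists>j. t < T j" for t
  proof (rule ccontr)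
    assume "\<nexists>j. t < T j"
    then have le: "T j \<le> t" for j by (meson not_less)
    obtain j where j: "pot (Z 0) + real N * ((1 - \<gamma>) * a * t) < real j * min_drop"
      using reals_Archimedean3[OF min_drop_pos] by blast
    have "real N * ((1 - \<gamma>) * a * T j) \<le> real N * ((1 - \<gamma>) * a * t)"
      using le rate_pos by (intro mult_left_mono) auto
    then show False using potZ[of j] pot_nonneg[of "Z j"] j by simp
  qed
  \<comment> \<open>Segment \<open>j\<close> covers the times in \<open>(T j, T (Suc j)]\<close>, so
    that \<open>W\<close> is left-continuous and shows the state before the impulses at
    \<open>T (Suc j)\<close>.\<close>
  define W where "W t = (if t \<le> 0 then x0 else
    let j = (LEAST j. t \<le> T (Suc j)) in flow (Z j) (t - T j))" for t
  have W0: "W 0 = x0" by (simp add: W_def)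
  have ex: "\<exists>j. T j < t \<and> t \<le> T (Suc j)" if "0 < t" for t
  proof -
    define j where "j = (LEAST j. t \<le> T (Suc j))"
    obtain i where "t < T i" using unb by auto
    then have "t \<le> T (Suc i)" using Tless[of i "Suc i"] by simp
    then have "t \<le> T (Suc j)" unfolding j_def by (rule LeastI)
    moreover have "T j < t"
    proof (cases j)
      case 0
      then show ?thesis using that T0 by simp
    next
      case (Suc i)
      then have "\<not> t \<le> T (Suc i)" using not_less_Least[of i "\<lambda>j. t \<le> T (Suc j)"] j_def by simp
      then show ?thesis using Suc by simp
    qed
    ultimately show ?thesis by blast
  qed
  have W: "W t = flow (Z j) (t - T j)" if "T j < t" "t \<le> T (Suc j)" for t j
  proof -
    have "(LEAST j. t \<le> T (Suc j)) = j"
    proof (rule Least_equality)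
      fix i assume "t \<le> T (Suc i)"
      show "j \<le> i"
      proof (rule ccontr)
        assume "\<not> j \<le> i"
        then have "T (Suc i) \<le> T j" by (intro Tle) auto
        then show False using \<open>t \<le> T (Suc i)\<close> that by simp
      qed
    qed (use that in auto)
    then show ?thesis using that T_nonneg[of j] by (simp add: W_def)
  qed
  have W_adm: "adm N (W t)" if "0 \<le> t" for t
  proof (cases "t = 0")
    case False
    then obtain j where "T j < t" "t \<le> T (Suc j)" using ex[of t] \<open>0 \<le> t\<close> by auto
    then show ?thesis using W[of j t] Z flow_adm[of "Z j" "t - T j"] by simp
  qed (use W0 x0 in simp)
  have u_W: "u (W t) = {}" if "T j < t" "t < T (Suc j)" for t j
    using W[of j t] hitZ(3)[of "t - T j" j] that TS by simp
  have ev_right: "\<forall>\<^sub>F s in at_right (T j). W s = flow (Z j) (s - T j)" for j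
    using Tless[of j "Suc j"] by (intro eventually_at_rightI[of "T j" "T (Suc j)"] W) auto
  have flow_lim: "((\<lambda>s. flow (Z j) (s - T j) k) \<longlongrightarrow> flow (Z j) (t - T j) k) (at t within A)"
    if "T j \<le> t" for j t k A
  proof -
    have "isCont (\<lambda>s. flow (Z j) (s - T j) k) t"
      by (rule isCont_o2[where f = "\<lambda>s. s - T j" and g = "\<lambda>s. flow (Z j) s k"])
        (use flow_isCont[of "Z j" "t - T j" k] Z that in auto)
    from continuous_at_imp_continuous_at_within[OF this, of A] show ?thesis
      by (simp add: continuous_within)
  qed
  have right: "((\<lambda>s. W s k) \<longlongrightarrow> Z j k) (at_right (T j))" for j k
  proof -
    have "((\<lambda>s. flow (Z j) (s - T j) k) \<longlongrightarrow> Z j k) (at_right (T j))"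
      using flow_lim[of j "T j" k] Z flow_0[of "Z j"] by simp
    then show ?thesis
      by (rule Lim_transform_eventually) (rule eventually_mono[OF ev_right[of j]], simp)
  qed
  have "is_trajectory a b \<gamma> u N x W"
    unfolding is_trajectory_def
  proof (intro conjI allI impI ballI)
    show "W 0 k = x k" if "k \<in> {1..N}" for k using that by (simp add: W0 x0_def)
    show "W t k = 0" if "0 \<le> t" "k \<notin> {1..N}" for t k using W_adm[OF that(1)] that(2) by (rule adm_zero)
    show "0 < W t k" if "0 \<le> t" "k \<in> {1..N}" for t k using W_adm[OF that(1)] that(2) by (rule adm_pos)
    show "finite (impulse_times u W \<inter> {0..\<tau>})" for \<tau>
    proof -
      obtain J where J: "\<tau> < T J" using unb by auto
      have "impulse_times u W \<inter> {0..\<tau>} \<subseteq> insert 0 (T ` {..J})"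
      proof
        fix t assume t: "t \<in> impulse_times u W \<inter> {0..\<tau>}"
        show "t \<in> insert 0 (T ` {..J})"
        proof (cases "t = 0")
          case False
          then obtain j where j: "T j < t" "t \<le> T (Suc j)" using ex[of t] t by auto
          then have "t = T (Suc j)" using u_W[of j t] t by (force simp: impulse_times_def)
          moreover have "Suc j \<le> J"
          proof (rule ccontr)
            assume "\<not> Suc j \<le> J"
            then have "T J \<le> T j" by (intro Tle) auto
            then show False using J j t by auto
          qed
          ultimately show ?thesis by blast
        qed simp
      qed
      then show ?thesis by (rule finite_subset) auto
    qed
  next
    fix t :: real and k assume t: "0 < t" "t \<notin> impulse_times u W" and k: "k \<in> {1..N}"
    obtain j where j: "T j < t" "t \<le> T (Suc j)" using ex[OF t(1)] by auto
    \<comment> \<open>At \<open>T (Suc j)\<close> an impulse is due, so a time without impulse is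
      interior to its segment and \<open>W\<close> agrees with the flow nearby.\<close>
    have "u (W (T (Suc j))) \<noteq> {}"
      using W[of j "T (Suc j)"] Tless[of j "Suc j"] hitZ(2)[of j] by (simp add: TS)
    then have "t \<noteq> T (Suc j)" using t by (auto simp: impulse_times_def)
    then have j': "t < T (Suc j)" using j by simp
    have "((\<lambda>s. flow (Z j) (s - T j) k) has_real_derivative a * W t k powr \<gamma> * 1) (at t)"
      unfolding W[OF j] using j Z k
      by (intro DERIV_chain2[where f = "\<lambda>s. flow (Z j) s k"] flow_deriv) (auto intro!: derivative_eq_intros)
    moreover have "\<forall>\<^sub>F s in nhds t. W s k = flow (Z j) (s - T j) k"
      using j j' by (intro eventually_nhds_in_open[of "{T j<..<T (Suc j)}", THEN eventually_mono]) (auto simp: W[of j])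
    ultimately show "((\<lambda>s. W s k) has_real_derivative a * W t k powr \<gamma>) (at t)"
      by (subst DERIV_cong_ev[OF refl _ refl]) auto
  next
    fix t :: real and k assume t: "0 < t"
    obtain j where j: "T j < t" "t \<le> T (Suc j)" using ex[OF t] by auto
    have ev: "\<forall>\<^sub>F s in at_left t. flow (Z j) (s - T j) k = W s k"
      using j by (intro eventually_at_leftI[of "T j"]) (auto simp: W[of j])
    show "((\<lambda>s. W s k) \<longlongrightarrow> W t k) (at_left t)"
      unfolding W[OF j] using j by (intro Lim_transform_eventually[OF flow_lim ev]) simp
  next
    fix t :: real and k assume t: "0 \<le> t"
    show "((\<lambda>s. W s k) \<longlongrightarrow> post_state b u (W t) k) (at_right t)"
    proof (cases "t = 0")
      case True
      then show ?thesis using right[of k 0] by (simp add: T0 Z0 W0)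
    next
      case False
      then obtain j where j: "T j < t" "t \<le> T (Suc j)" using ex[of t] t by auto
      show ?thesis
      proof (cases "t = T (Suc j)")
        case True
        then show ?thesis using right[of k "Suc j"] W[OF j] by (simp add: ZS TS)
      next
        case False
        then have j': "t < T (Suc j)" using j by simp
        have ev: "\<forall>\<^sub>F s in at_right t. flow (Z j) (s - T j) k = W s k"
          using j j' by (intro eventually_at_rightI[of t "T (Suc j)"]) (auto simp: W[of j])
        have "post_state b u (W t) = flow (Z j) (t - T j)"
          using post_none[of u "W t"] u_W[OF j(1) j'] W[OF j] by simp
        then show ?thesis
          using j Lim_transform_eventually[OF flow_lim ev] by simp
      qed
    qed
  qed
  then show ?thesis by blast
qed

lemma trajectory:
  "(\<And>k. k \<in> {1..N} \<Longrightarrow> 0 < x k) \<Longrightarrow> is_trajectory a b \<gamma> u N x (trajectory a b \<gamma> u N x)"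
  unfolding trajectory_def by (rule someI_ex[OF ex_trajectory])

end

context gaimd
begin

subsection \<open>Long-run averages\<close>

text \<open>The average reward of a user over a cycle in which the rate grows from \<open>b * M\<close> to \<open>M\<close>.\<close>

definition gain :: "real \<Rightarrow> real \<Rightarrow> real" where
  "gain \<alpha> M = (1 - \<gamma>) * (1 - b powr (2 - \<alpha> - \<gamma>)) /
     ((2 - \<alpha> - \<gamma>) * (1 - \<alpha>) * (1 - b powr (1 - \<gamma>))) * M powr (1 - \<alpha>)"

text \<open>The function \<open>H\<close> of the introduction: along the flow the first term grows
  at the rate of the reward, and the second subtracts growth at rate \<open>L\<close>.\<close>

definition reward_prim :: "real \<Rightarrow> real \<Rightarrow> real \<Rightarrow> real" where
  "reward_prim \<alpha> L x = x powr (2 - \<alpha> - \<gamma>) / ((2 - \<alpha> - \<gamma>) * (1 - \<alpha>) * a) - L * x powr (1 - \<gamma>) / ((1 - \<gamma>) * a)"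

text \<open>Rests on \<open>M powr (2 - \<alpha> - \<gamma>) = M powr (1 - \<alpha>) * M powr (1 -
  \<gamma>)\<close>. The last factor is the time the flow needs from \<open>b * M\<close> to
  \<open>M\<close>, so the drop is the excess of the reward over \<open>L\<close> accumulated in one
  cycle.\<close>

lemma reward_prim_drop:
  assumes "0 < M" "\<alpha> \<noteq> 1" "2 - \<alpha> - \<gamma> \<noteq> 0"
  shows "reward_prim \<alpha> L M - reward_prim \<alpha> L (b * M) =
    (gain \<alpha> M - L) * ((M powr (1 - \<gamma>) - (b * M) powr (1 - \<gamma>)) / ((1 - \<gamma>) * a))"
proof -
  define d where "d = 1 - b powr (1 - \<gamma>)"
  define e where "e = 2 - \<alpha> - \<gamma>"
  define p where "p = 1 - \<gamma>"
  have nz: "d \<noteq> 0" "e \<noteq> 0" "p \<noteq> 0" "1 - \<alpha> \<noteq> 0" "a \<noteq> 0"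
    using bpow a g assms by (auto simp: d_def e_def p_def)
  have M: "M powr e = M powr (1 - \<alpha>) * M powr p"
    by (simp add: e_def p_def powr_add[symmetric] algebra_simps)
  have "reward_prim \<alpha> L M - reward_prim \<alpha> L (b * M) =
      M powr e * (1 - b powr e) / (e * (1 - \<alpha>) * a) - L * (M powr p * d) / (p * a)"
    unfolding reward_prim_def e_def[symmetric] p_def[symmetric] d_def
    using assms b by (simp add: powr_mult diff_divide_distrib right_diff_distrib mult.commute)
  also have "\<dots> = (p * (1 - b powr e) / (e * (1 - \<alpha>) * d) * M powr (1 - \<alpha>) - L) * (M powr p * d / (p * a))"
    unfolding M using nz by (simp add: field_simps)
  also have "\<dots> = (gain \<alpha> M - L) * ((M powr (1 - \<gamma>) - (b * M) powr (1 - \<gamma>)) / ((1 - \<gamma>) * a))"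
    using assms b by (simp add: gain_def e_def p_def d_def powr_mult algebra_simps)
  finally show ?thesis .
qed

lemma flow_mono: "adm N z \<Longrightarrow> 0 \<le> s \<Longrightarrow> k \<in> {1..N} \<Longrightarrow> z k \<le> flow z s k"
  using flow_powr[of z s k] rate_pos adm_pos[of N z k] adm_pos[OF flow_adm, of z s k] g
    powr_less_mono2[of "1 - \<gamma>" "flow z s k" "z k"] by (smt (verit) mult_nonneg_nonneg)

text \<open>The fundamental theorem of calculus, written with \<open>L\<close> so that summation
  over segments leaves only boundary terms and the jumps of \<open>reward_prim\<close> at
  impulses.\<close>

lemma flow_integral:
  assumes z: "adm N z" and t: "t' \<le> t" and k: "k \<in> {1..N}" and \<alpha>: "\<alpha> \<noteq> 1" "2 - \<alpha> - \<gamma> \<noteq> 0"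
  shows "((\<lambda>s. flow z (s - t') k powr (1 - \<alpha>) / (1 - \<alpha>)) has_integral
    L * (t - t') + reward_prim \<alpha> L (flow z (t - t') k) - reward_prim \<alpha> L (z k)) {t'..t}"
proof -
  define G where "G s = flow z (s - t') k powr (2 - \<alpha> - \<gamma>) / ((2 - \<alpha> - \<gamma>) * (1 - \<alpha>) * a)" for s
  have "((\<lambda>s. flow z (s - t') k powr (1 - \<alpha>) / (1 - \<alpha>)) has_integral G t - G t') {t'..t}"
  proof (rule fundamental_theorem_of_calculus[OF t])
    fix s assume s: "s \<in> {t'..t}"
    have pos: "0 < flow z (s - t') k" using adm_pos[OF flow_adm[OF z]] s k by simp
    have d: "((\<lambda>s. flow z (s - t') k) has_real_derivative a * flow z (s - t') k powr \<gamma> * 1) (at s)"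
      using s z k by (intro DERIV_chain2[where f = "\<lambda>s. flow z s k"] flow_deriv) (auto intro!: derivative_eq_intros)
    have "(G has_real_derivative ((2 - \<alpha> - \<gamma>) * flow z (s - t') k powr (2 - \<alpha> - \<gamma> - 1)) *
        (a * flow z (s - t') k powr \<gamma> * 1) / ((2 - \<alpha> - \<gamma>) * (1 - \<alpha>) * a)) (at s)"
      unfolding G_def
      by (intro DERIV_cdivide DERIV_chain2[where f = "\<lambda>x. x powr (2 - \<alpha> - \<gamma>)", OF has_real_derivative_powr[OF pos] d])
    moreover have "flow z (s - t') k powr (2 - \<alpha> - \<gamma> - 1) * flow z (s - t') k powr \<gamma> = flow z (s - t') k powr (1 - \<alpha>)"
      by (simp add: powr_add[symmetric])
    then have "((2 - \<alpha> - \<gamma>) * flow z (s - t') k powr (2 - \<alpha> - \<gamma> - 1)) *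
        (a * flow z (s - t') k powr \<gamma> * 1) / ((2 - \<alpha> - \<gamma>) * (1 - \<alpha>) * a) = flow z (s - t') k powr (1 - \<alpha>) / (1 - \<alpha>)"
      using \<alpha> a by (simp add: mult.commute mult.left_commute)
    ultimately have "(G has_real_derivative flow z (s - t') k powr (1 - \<alpha>) / (1 - \<alpha>)) (at s)"
      by (simp only:)
    then show "(G has_vector_derivative flow z (s - t') k powr (1 - \<alpha>) / (1 - \<alpha>)) (at s within {t'..t})"
      by (simp add: has_real_derivative_iff_has_vector_derivative has_vector_derivative_at_within)
  qed
  moreover have "G t - G t' = L * (t - t') + reward_prim \<alpha> L (flow z (t - t') k) - reward_prim \<alpha> L (z k)"
  proof -
    have "L * flow z (t - t') k powr (1 - \<gamma>) / ((1 - \<gamma>) * a) = L * z k powr (1 - \<gamma>) / ((1 - \<gamma>) * a) + L * (t - t')"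
      using flow_powr[OF z, of "t - t'" k] t k a g by (simp add: add_divide_distrib distrib_left)
    then show ?thesis using flow_0[OF z] by (simp add: G_def reward_prim_def)
  qed
  ultimately show ?thesis by simp
qed

text \<open>The integral differs from \<open>L * t\<close> by boundary terms and by the jumps of
  \<open>reward_prim\<close>. Each jump is at most \<kappa> times the time needed to regrow what was
  lost, and these times add up to at most \<open>t\<close> plus a constant.\<close>

lemma time_average:
  assumes X: "is_trajectory a b \<gamma> u N x X" and k: "k \<in> {1..N}" and \<alpha>: "\<alpha> \<noteq> 1" "2 - \<alpha> - \<gamma> \<noteq> 0"
    and single: "\<And>t. 0 < t \<Longrightarrow> u (X t) \<noteq> {} \<Longrightarrow> post_state b u (X t) = impulse b (u (X t)) (X t)"
    and peak: "\<And>t. 0 < t \<Longrightarrow> k \<in> u (X t) \<Longrightarrow> m \<le> X t k \<and> \<bar>gain \<alpha> (X t k) - L\<bar> \<le> \<kappa>"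
    and m: "0 < m" and \<kappa>: "0 \<le> \<kappa>" and up: "\<And>t. 0 < t \<Longrightarrow> X t k \<le> B"
  shows "\<exists>l. Liminf at_top (\<lambda>\<tau>. ereal (1 / \<tau> * integral {0..\<tau>} (\<lambda>t. X t k powr (1 - \<alpha>) / (1 - \<alpha>)))) = ereal l
    \<and> \<bar>l - L\<bar> \<le> \<kappa>"
proof -
  define r where "r = (1 - \<gamma>) * a"
  have r: "0 < r" unfolding r_def by (rule rate_pos)
  define f where "f t = X t k powr (1 - \<alpha>) / (1 - \<alpha>)" for t
  define w where "w = post_state b u (X 0) k"
  \<comment> \<open>A lower bound for the rate at positive times: it starts at \<open>w\<close>
    after the initial impulses, and later impulses act only on rates of at least
    \<open>m\<close>.\<close>
  define l where "l = min w (b * m)"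
  have X0: "adm N (X 0)" using traj_adm[OF X] by simp
  have wpos: "0 < w" unfolding w_def using adm_pos[OF post_adm[OF X0] k] .
  have l: "0 < l" using wpos m b by (simp add: l_def)
  \<comment> \<open>The last factor is the total lowering of
    \<open>X s k powr (1 - \<gamma>)\<close> by impulses strictly between 0 and \<open>t\<close>,
    expressed through the growth and the current value, divided by \<open>r\<close>.\<close>
  define P where "P t \<longleftrightarrow> l \<le> X t k \<and> (\<exists>I. (f has_integral I) {0..t} \<and>
    \<bar>I - L * t - reward_prim \<alpha> L (X t k) + reward_prim \<alpha> L w\<bar> \<le> \<kappa> * ((w powr (1 - \<gamma>) + r * t - X t k powr (1 - \<gamma>)) / r))" for t
  have P: "P t" if "0 < t" for t
  proof (rule traj_induct[OF X that])
    fix t' t :: real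
    assume t: "0 \<le> t'" "t' < t" and cas: "t' = 0 \<or> P t' \<and> u (X t') \<noteq> {}"
      and fl: "\<And>s. t' < s \<Longrightarrow> s \<le> t \<Longrightarrow> X s = flow (post_state b u (X t')) (s - t')"
    define z where "z = post_state b u (X t')"
    have z: "adm N z" unfolding z_def using traj_adm[OF X] t by (intro post_adm) auto
    have Xt: "X t = flow z (t - t')" unfolding z_def using fl t by simp
    have grow: "X t k powr (1 - \<gamma>) = z k powr (1 - \<gamma>) + r * (t - t')"
      unfolding Xt r_def using flow_powr[OF z] t k by simp
    have zX: "z k \<le> X t k" unfolding Xt using flow_mono z t k by simp
    define I1 where "I1 = L * (t - t') + reward_prim \<alpha> L (X t k) - reward_prim \<alpha> L (z k)"
    have "((\<lambda>s. flow z (s - t') k powr (1 - \<alpha>) / (1 - \<alpha>)) has_integral I1) {t'..t}"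
      unfolding I1_def Xt using z t k \<alpha> by (intro flow_integral) auto
    \<comment> \<open>At \<open>t'\<close> itself \<open>X\<close> still has the value before the
      impulses, so the integrands may differ at that one point.\<close>
    then have I1: "(f has_integral I1) {t'..t}"
      by (rule has_integral_spike_finite[of "{t'}", rotated 2]) (auto simp: f_def fl z_def)
    show "P t"
    proof (cases "t' = 0")
      case True
      then have "z k = w" by (simp add: z_def w_def)
      moreover from this have "w powr (1 - \<gamma>) + r * t - X t k powr (1 - \<gamma>) = 0" using grow True by simp
      ultimately show ?thesis using True I1 zX unfolding P_def
        by (intro conjI exI[of _ I1]) (auto simp: I1_def l_def)
    next
      case False
      then have P': "P t'" and u: "u (X t') \<noteq> {}" and t0: "0 < t'" using cas t by auto
      have zeq: "z = impulse b (u (X t')) (X t')" unfolding z_def using single[OF t0 u] .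
      have pos: "0 < X t' k" using adm_pos[OF traj_adm[OF X]] t k by simp
      obtain I where I: "(f has_integral I) {0..t'}" and lX: "l \<le> X t' k"
        and bd: "\<bar>I - L * t' - reward_prim \<alpha> L (X t' k) + reward_prim \<alpha> L w\<bar> \<le> \<kappa> * ((w powr (1 - \<gamma>) + r * t' - X t' k powr (1 - \<gamma>)) / r)"
        using P' unfolding P_def by auto
      have jump: "l \<le> z k \<and> \<bar>reward_prim \<alpha> L (X t' k) - reward_prim \<alpha> L (z k)\<bar> \<le> \<kappa> * ((X t' k powr (1 - \<gamma>) - z k powr (1 - \<gamma>)) / r)"
      proof (cases "k \<in> u (X t')")
        case True
        then have zk: "z k = b * X t' k" by (simp add: zeq impulse_def)
        have "0 \<le> (X t' k powr (1 - \<gamma>) - (b * X t' k) powr (1 - \<gamma>)) / r"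
          using pos b g r by (auto intro!: divide_nonneg_pos powr_mono2 simp: mult_le_cancel_right1)
        moreover have "b * m \<le> b * X t' k" using peak[OF t0 True] b by simp
        ultimately show ?thesis
          unfolding zk reward_prim_drop[OF pos \<alpha>] r_def[symmetric] abs_mult
          using peak[OF t0 True] by (auto simp only: l_def abs_of_nonneg intro!: mult_right_mono)
      next
        case False
        then show ?thesis using lX by (simp add: zeq impulse_def)
      qed
      have "(f has_integral I + I1) {0..t}"
        using has_integral_combine[OF _ _ I I1] t by simp
      moreover have "\<bar>(I + I1) - L * t - reward_prim \<alpha> L (X t k) + reward_prim \<alpha> L w\<bar>
          \<le> \<kappa> * ((w powr (1 - \<gamma>) + r * t - X t k powr (1 - \<gamma>)) / r)"
      proof -
        have "(I + I1) - L * t - reward_prim \<alpha> L (X t k) + reward_prim \<alpha> L w =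
          (I - L * t' - reward_prim \<alpha> L (X t' k) + reward_prim \<alpha> L w) + (reward_prim \<alpha> L (X t' k) - reward_prim \<alpha> L (z k))"
          by (simp add: I1_def algebra_simps)
        moreover have "\<kappa> * ((w powr (1 - \<gamma>) + r * t - X t k powr (1 - \<gamma>)) / r) =
            \<kappa> * ((w powr (1 - \<gamma>) + r * t' - X t' k powr (1 - \<gamma>)) / r) + \<kappa> * ((X t' k powr (1 - \<gamma>) - z k powr (1 - \<gamma>)) / r)"
          unfolding grow distrib_left[symmetric] add_divide_distrib[symmetric] by (simp add: right_diff_distrib)
        ultimately show ?thesis using bd jump by linarith
      qed
      ultimately show ?thesis using jump zX unfolding P_def by (intro conjI exI[of _ "I + I1"]) auto
    qed
  qed
  \<comment> \<open>The rate stays in a compact interval away from 0, so the boundary terms are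
    bounded and vanish after division by \<open>t\<close>.\<close>
  have "continuous_on {l..B} (reward_prim \<alpha> L)"
    unfolding reward_prim_def using l a g \<alpha> by (intro continuous_intros) auto
  then have "bounded (reward_prim \<alpha> L ` {l..B})"
    by (intro compact_imp_bounded compact_continuous_image) auto
  then obtain K where K: "\<And>y. y \<in> {l..B} \<Longrightarrow> \<bar>reward_prim \<alpha> L y\<bar> \<le> K"
    unfolding bounded_iff by fastforce
  define E where "E = K + \<bar>reward_prim \<alpha> L w\<bar> + \<kappa> * (w powr (1 - \<gamma>) / r)"
  have avg: "\<bar>1 / t * integral {0..t} f - L\<bar> \<le> \<kappa> + E / t" if t: "0 < t" for t
  proof -
    obtain I where I: "(f has_integral I) {0..t}" and lX: "l \<le> X t k"
      and bd: "\<bar>I - L * t - reward_prim \<alpha> L (X t k) + reward_prim \<alpha> L w\<bar> \<le> \<kappa> * ((w powr (1 - \<gamma>) + r * t - X t k powr (1 - \<gamma>)) / r)"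
      using P[OF t] unfolding P_def by auto
    have "\<kappa> * ((w powr (1 - \<gamma>) + r * t - X t k powr (1 - \<gamma>)) / r) \<le> \<kappa> * ((w powr (1 - \<gamma>) + r * t) / r)"
      using \<kappa> r by (intro mult_left_mono divide_right_mono) auto
    also have "\<dots> = \<kappa> * (w powr (1 - \<gamma>) / r) + \<kappa> * t"
      using r by (simp add: field_simps)
    finally have "\<bar>I - L * t\<bar> \<le> \<kappa> * t + E"
      using bd K[of "X t k"] lX up[OF t] unfolding E_def by auto
    moreover have "1 / t * integral {0..t} f - L = (I - L * t) / t"
      using integral_unique[OF I] t by (simp add: field_simps)
    ultimately show ?thesis using t by (simp add: field_simps)
  qed
  have E: "((\<lambda>t. E / t) \<longlongrightarrow> 0) at_top"
    by (rule real_tendsto_divide_at_top[OF tendsto_const filterlim_ident])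
  have ev: "\<forall>\<^sub>F t in at_top. \<bar>1 / t * integral {0..t} f - L\<bar> \<le> \<kappa> + E / t"
    using eventually_gt_at_top[of "0::real"] by (rule eventually_mono) (rule avg)
  let ?F = "\<lambda>\<tau>. ereal (1 / \<tau> * integral {0..\<tau>} f)"
  have "Liminf at_top (\<lambda>t. ereal (L - \<kappa> - E / t)) \<le> Liminf at_top ?F"
    by (rule Liminf_mono, rule eventually_mono[OF ev], unfold ereal_less_eq) linarith
  moreover have "Liminf at_top (\<lambda>t. ereal (L - \<kappa> - E / t)) = ereal (L - \<kappa> - 0)"
    using E by (intro lim_imp_Liminf tendsto_intros) auto
  moreover have "Liminf at_top ?F \<le> Liminf at_top (\<lambda>t. ereal (L + \<kappa> + E / t))"
    by (rule Liminf_mono, rule eventually_mono[OF ev], unfold ereal_less_eq) linarith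
  moreover have "Liminf at_top (\<lambda>t. ereal (L + \<kappa> + E / t)) = ereal (L + \<kappa> + 0)"
    using E by (intro lim_imp_Liminf tendsto_intros) auto
  ultimately have "ereal (L - \<kappa>) \<le> Liminf at_top ?F" "Liminf at_top ?F \<le> ereal (L + \<kappa>)"
    by simp_all
  then show ?thesis
    unfolding f_def[symmetric] by (cases "Liminf at_top ?F") (auto simp: abs_le_iff)
qed

section \<open>First hitting times and left limits\<close>

lemma flow_continuous_on: "adm N z \<Longrightarrow> continuous_on {0..} (\<lambda>s. flow z s k)"
  using flow_isCont by (intro continuous_at_imp_continuous_on) auto

lemma flow_reaches:
  assumes z: "adm N z" and k: "k \<in> {1..N}" and K: "0 < K"
  shows "\<exists>s\<ge>0. K \<le> flow z s k"
proof (intro exI conjI)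
  \<comment> \<open>By this time growth alone contributes \<open>K powr (1 - \<gamma>)\<close>,
    whatever the start.\<close>
  define s where "s = K powr (1 - \<gamma>) / ((1 - \<gamma>) * a)"
  show s: "0 \<le> s" using rate_pos by (simp add: s_def)
  have "K powr (1 - \<gamma>) \<le> flow z s k powr (1 - \<gamma>)"
    using flow_powr[OF z s k] a g by (simp add: s_def)
  then have "(K powr (1 - \<gamma>)) powr (1 / (1 - \<gamma>)) \<le> (flow z s k powr (1 - \<gamma>)) powr (1 / (1 - \<gamma>))"
    by (rule powr_mono2[rotated 2]) (use g in auto)
  then show "K \<le> flow z s k" using powr_root K adm_pos[OF flow_adm[OF z s] k] by simp
qed

text \<open>The infimum of a nonempty closed set of times is attained, and it is not 0 because no
  impulse is due at the start.\<close>

lemma first_hit: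
  assumes z: "adm N z" "u z = {}"
    and cl: "closed {s. 0 \<le> s \<and> u (flow z s) \<noteq> {}}" and ne: "\<exists>s\<ge>0. u (flow z s) \<noteq> {}"
  shows "\<exists>S>0. u (flow z S) \<noteq> {} \<and> (\<forall>s. 0 \<le> s \<longrightarrow> s < S \<longrightarrow> u (flow z s) = {})"
proof -
  define A where "A = {s. 0 \<le> s \<and> u (flow z s) \<noteq> {}}"
  have bdd: "bdd_below A" by (auto simp: A_def intro: bdd_belowI)
  have S: "Inf A \<in> A" using ne cl bdd by (intro closed_contains_Inf) (auto simp: A_def)
  then have "Inf A \<noteq> 0" using z flow_0[OF z(1)] by (auto simp: A_def)
  moreover have "u (flow z s) = {}" if "0 \<le> s" "s < Inf A" for s
  proof (rule ccontr)
    assume "u (flow z s) \<noteq> {}"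
    then have "Inf A \<le> s" using that bdd by (intro cInf_lower) (auto simp: A_def)
    with that show False by simp
  qed
  ultimately show ?thesis using S by (intro exI[of _ "Inf A"]) (auto simp: A_def)
qed

lemma closed_above:
  assumes "continuous_on {0..} f"
  shows "closed {s. 0 \<le> s \<and> (K::real) \<le> f (s::real)}"
proof -
  have "closed (f -` {K..} \<inter> {0..})"
    using assms by (rule continuous_on_closed_vimage[THEN iffD1, rule_format, rotated]) auto
  also have "f -` {K..} \<inter> {0..} = {s. 0 \<le> s \<and> K \<le> f s}" by auto
  finally show ?thesis .
qed

text \<open>Impulse times do not accumulate. Together with left continuity this carries bounds that
  hold while no impulse is due over to \<open>t\<close> itself.\<close>

lemma traj_left:
  assumes X: "is_trajectory a b \<gamma> u N x X" and t: "0 < t"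
  shows "\<forall>\<^sub>F s in at_left t. 0 \<le> s \<and> u (X s) = {}"
proof -
  have "\<exists>t'\<ge>0. t' < t \<and> (\<forall>s. t' < s \<longrightarrow> s < t \<longrightarrow> u (X s) = {})"
    by (rule traj_induct[OF X t]) blast
  then obtain t' where t': "0 \<le> t'" "t' < t" "\<And>s. t' < s \<Longrightarrow> s < t \<Longrightarrow> u (X s) = {}" by blast
  then show ?thesis by (intro eventually_at_leftI[of t']) auto
qed

lemma traj_tendsto_left:
  "is_trajectory a b \<gamma> u N x X \<Longrightarrow> 0 < t \<Longrightarrow> k \<in> {1..N} \<Longrightarrow> ((\<lambda>s. X s k) \<longlongrightarrow> X t k) (at_left t)"
  unfolding is_trajectory_def by blast

subsection \<open>The threshold policy\<close>

lemma threshold_pos: "0 < C \<Longrightarrow> 1 \<le> N \<Longrightarrow> 0 < threshold b \<gamma> C N"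
  using g b powr_less_mono2[of "1 - \<gamma>" b 1] powr_less_mono2[of "2 - \<gamma>" b 1]
  unfolding threshold_def by (intro mult_pos_pos divide_pos_pos) auto

text \<open>Left continuity prevents overshoot at positive times, so every impulse after time 0
  occurs exactly at the threshold and \<open>time_average\<close> applies with error 0.\<close>

lemma threshold_J:
  assumes N: "1 \<le> N" and C: "0 < C" and \<alpha>: "\<alpha> \<noteq> 1" "2 - \<alpha> - \<gamma> \<noteq> 0"
    and x: "\<And>k. k \<in> {1..N} \<Longrightarrow> 0 < x k"
  shows "J a b \<gamma> \<alpha> (threshold_policy b \<gamma>) x C N = ereal (real N * gain \<alpha> (threshold b \<gamma> C N))"
proof -
  define \<theta> where "\<theta> = threshold b \<gamma> C N"
  define u where "u = threshold_policy b \<gamma> C N"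
  have \<theta>: "0 < \<theta>" unfolding \<theta>_def using C N by (rule threshold_pos)
  have u: "u z = {k \<in> {1..N}. \<theta> \<le> z k}" for z
    by (auto simp: u_def threshold_policy_def \<theta>_def)
  interpret gaimd_policy a b \<gamma> N u \<theta>
  proof
    show "\<exists>k\<in>u z \<inter> {1..N}. \<theta> \<le> z k" if "u z \<noteq> {}" for z using that by (auto simp: u)
    fix z assume z: "adm N z" "u z = {}"
    have "{s. 0 \<le> s \<and> u (flow z s) \<noteq> {}} = (\<Union>k\<in>{1..N}. {s. 0 \<le> s \<and> \<theta> \<le> flow z s k})"
      by (auto simp: u)
    moreover have "closed (\<Union>k\<in>{1..N}. {s. 0 \<le> s \<and> \<theta> \<le> flow z s k})"
      by (intro closed_UN ballI closed_above flow_continuous_on z) auto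
    moreover have "\<exists>s\<ge>0. u (flow z s) \<noteq> {}"
    proof -
      obtain s where "0 \<le> s" "\<theta> \<le> flow z s 1" using flow_reaches[OF z(1), of 1 \<theta>] N \<theta> by auto
      then have "1 \<in> u (flow z s)" using N by (auto simp: u)
      then show ?thesis using \<open>0 \<le> s\<close> by blast
    qed
    ultimately show "\<exists>S>0. u (flow z S) \<noteq> {} \<and> (\<forall>s. 0 \<le> s \<longrightarrow> s < S \<longrightarrow> u (flow z s) = {})"
      by (intro first_hit z) auto
  qed (rule \<theta>)
  define X where "X = trajectory a b \<gamma> u N x"
  have X: "is_trajectory a b \<gamma> u N x X" unfolding X_def by (rule trajectory[OF x])
  have up: "X t k \<le> \<theta>" if "0 < t" "k \<in> {1..N}" for t k
  proof (rule tendsto_upperbound[OF traj_tendsto_left[OF X that]])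
    show "\<forall>\<^sub>F s in at_left t. X s k \<le> \<theta>"
      using traj_left[OF X that(1)] by (rule eventually_mono) (use that in \<open>force simp: u\<close>)
  qed simp
  \<comment> \<open>All rates are at most \<theta>, so a user that was cut is strictly below it and
    one round is enough.\<close>
  have single: "post_state b u (X t) = imp u (X t)" if "0 < t" "u (X t) \<noteq> {}" for t
  proof (rule post_one[where u = u, OF that(2)])
    show "u (imp u (X t)) = {}"
    proof (rule ccontr)
      assume "u (imp u (X t)) \<noteq> {}"
      then obtain k where k: "k \<in> {1..N}" "\<theta> \<le> imp u (X t) k" by (auto simp: u[of "imp u (X t)"])
      have "b * X t k < X t k" using adm_pos[OF traj_adm[OF X], of t k] that k b by simp
      then show False using k up[OF that(1) k(1)] by (auto simp: impulse_def u split: if_splits)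
    qed
  qed
  have "Liminf at_top (\<lambda>\<tau>. ereal (1 / \<tau> * integral {0..\<tau>} (\<lambda>t. X t k powr (1 - \<alpha>) / (1 - \<alpha>)))) = ereal (gain \<alpha> \<theta>)"
    if k: "k \<in> {1..N}" for k
  proof -
    have "\<exists>l. Liminf at_top (\<lambda>\<tau>. ereal (1 / \<tau> * integral {0..\<tau>} (\<lambda>t. X t k powr (1 - \<alpha>) / (1 - \<alpha>)))) = ereal l
      \<and> \<bar>l - gain \<alpha> \<theta>\<bar> \<le> 0"
    proof (rule time_average[OF X k \<alpha> single])
      show "\<theta> \<le> X t k \<and> \<bar>gain \<alpha> (X t k) - gain \<alpha> \<theta>\<bar> \<le> 0" if "0 < t" "k \<in> u (X t)" for t
        using up[OF that(1) k] that(2) by (auto simp: u)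
    qed (use \<theta> up k in auto)
    then show ?thesis by auto
  qed
  then show ?thesis
    unfolding J_def u_def[symmetric] X_def[symmetric] \<theta>_def[symmetric] by simp
qed

end

subsection \<open>The index policy near the steady state\<close>

lemma powr_quotient_pos:
  fixes b e :: real
  assumes "0 < b" "b < 1" "e \<noteq> 0"
  shows "0 < (1 - b powr e) / e"
proof (cases "0 < e")
  case True
  then show ?thesis using powr_less_mono2[of e b 1] assms by simp
next
  case False
  then have "1 < b powr e" using powr_less_mono2_neg[of e b 1] assms by simp
  then show ?thesis using False assms by (intro divide_neg_neg) auto
qed

context gaimd
begin

text \<open>The constant factor is positive and the power is decreasing, so minimal index means
  maximal rate.\<close>

lemma index_fun_less:
  assumes \<alpha>: "0 < \<alpha>" "2 - \<alpha> - \<gamma> \<noteq> 0" and x: "0 < x" "x < y"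
  shows "index_fun b \<gamma> \<alpha> y < index_fun b \<gamma> \<alpha> x"
proof -
  have "0 < ((2 - \<gamma>) / (1 - b powr (2 - \<gamma>))) * ((1 - b powr (2 - \<alpha> - \<gamma>)) / (2 - \<alpha> - \<gamma>))"
    using g b \<alpha> powr_less_mono2[of "2 - \<gamma>" b 1]
    by (intro mult_pos_pos powr_quotient_pos divide_pos_pos) auto
  moreover have "y powr (- \<alpha>) < x powr (- \<alpha>)"
    using x \<alpha> by (intro powr_less_mono2_neg) auto
  ultimately show ?thesis
    unfolding index_fun_def by (intro mult_strict_left_mono) auto
qed

text \<open>\<open>steady_level M\<close> is the steady state in the coordinates \<open>x powr (1 - \<gamma>)\<close>, in which it is equally spaced.
  \<open>\<pi> k\<close> is the rank of user \<open>k\<close>.  The flow shifts all deviations from \<open>steady_level M\<close> equally; when the sum of the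
  rates is \<open>C\<close> the deviations have both signs, so that an impulse, which scales one deviation
  by \<open>b powr (1 - \<gamma>)\<close> and shifts the ranks cyclically, does not widen their range.\<close>

definition steady_level :: "real \<Rightarrow> nat \<Rightarrow> real" where
  "steady_level M n = M * (b powr (1 - \<gamma>) + real (N - n + 1) / real N * (1 - b powr (1 - \<gamma>)))"

text \<open>The spacing of consecutive levels, and the growth between consecutive impulses in the
  steady state.\<close>

definition gap :: "real \<Rightarrow> real" where
  "gap M = M * (1 - b powr (1 - \<gamma>)) / real N"

definition near :: "real \<Rightarrow> state \<Rightarrow> (nat \<Rightarrow> nat) \<Rightarrow> real \<Rightarrow> real \<Rightarrow> bool" where
  "near M z \<pi> lo hi \<longleftrightarrow> bij_betw \<pi> {1..N} {1..N} \<and>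
     (\<forall>k\<in>{1..N}. steady_level M (\<pi> k) + lo \<le> z k powr (1 - \<gamma>) \<and> z k powr (1 - \<gamma>) \<le> steady_level M (\<pi> k) + hi)"

text \<open>Rank 1 belongs to the largest rate: the user that is cut moves to the bottom and all
  others move up by one.\<close>

definition rot_rank :: "nat \<Rightarrow> nat" where
  "rot_rank n = (if n = 1 then N else n - 1)"

context
  fixes \<alpha> C :: real and tie :: "nat \<Rightarrow> state \<Rightarrow> nat set \<Rightarrow> nat" and u :: "state \<Rightarrow> nat set"
  assumes \<alpha>: "0 < \<alpha>" "\<alpha> \<noteq> 1" "2 - \<alpha> - \<gamma> \<noteq> 0" and N: "1 \<le> N" and C: "0 < C"
    and tie: "\<And>N x S. S \<noteq> {} \<Longrightarrow> tie N x S \<in> S"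
  defines "u \<equiv> index_policy b \<gamma> \<alpha> tie C N"
begin

lemma index_empty: "u z = {} \<longleftrightarrow> (\<Sum>k=1..N. z k) < C"
  by (simp add: u_def index_policy_def not_le)

lemma index_max:
  assumes z: "adm N z" "C \<le> (\<Sum>k=1..N. z k)"
  shows "\<exists>j\<in>{1..N}. u z = {j} \<and> (\<forall>i\<in>{1..N}. z i \<le> z j)"
proof -
  define S where "S = {k. is_arg_min (\<lambda>k. index_fun b \<gamma> \<alpha> (z k)) (\<lambda>k. k \<in> {1..N}) k}"
  define j where "j = tie N z S"
  have "S \<noteq> {}"
    using ex_is_arg_min_if_finite[of "{1..N}" "\<lambda>k. index_fun b \<gamma> \<alpha> (z k)"] N by (auto simp: S_def)
  then have "j \<in> S" unfolding j_def by (rule tie)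
  then have j: "j \<in> {1..N}" "\<And>i. i \<in> {1..N} \<Longrightarrow> \<not> index_fun b \<gamma> \<alpha> (z i) < index_fun b \<gamma> \<alpha> (z j)"
    unfolding S_def is_arg_min_def by blast+
  have "u z = {j}" using z by (simp add: u_def index_policy_def j_def S_def)
  moreover have "z i \<le> z j" if "i \<in> {1..N}" for i
    using j(2)[OF that] index_fun_less[OF \<alpha>(1,3) adm_pos[OF z(1) j(1)], of "z i"] by force
  ultimately show ?thesis using j by blast
qed

text \<open>When the sum reaches \<open>C\<close>, the largest rate is at least the average
  \<open>C / real N\<close>; the sum does reach \<open>C\<close> because a single rate can grow that
  far.\<close>

lemma index_gaimd_policy: "gaimd_policy a b \<gamma> N u (C / real N)"
proof
  show "0 < C / real N" using C N by simp
  fix z assume z: "adm N z"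
  {
    assume "u z \<noteq> {}"
    then have ge: "C \<le> (\<Sum>k=1..N. z k)" using index_empty[of z] by simp
    from index_max[OF z this] obtain j where j: "j \<in> {1..N}" "u z = {j}" "\<forall>i\<in>{1..N}. z i \<le> z j" by blast
    have "(\<Sum>k=1..N. z k) \<le> real (card {1..N}) * z j" using j by (intro sum_bounded_above) auto
    then have "C / real N \<le> z j" using ge N by (simp add: field_simps)
    then show "\<exists>k\<in>u z \<inter> {1..N}. C / real N \<le> z k" using j by auto
  }
  assume u0: "u z = {}"
  have "{s. 0 \<le> s \<and> u (flow z s) \<noteq> {}} = {s. 0 \<le> s \<and> C \<le> (\<Sum>k=1..N. flow z s k)}"
    by (auto simp: index_empty)
  moreover have "closed {s. 0 \<le> s \<and> C \<le> (\<Sum>k=1..N. flow z s k)}"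
    by (intro closed_above continuous_on_sum flow_continuous_on z)
  moreover have "\<exists>s\<ge>0. u (flow z s) \<noteq> {}"
  proof -
    obtain s where s: "0 \<le> s" "C \<le> flow z s 1" using flow_reaches[OF z, of 1 C] N C by auto
    have "flow z s 1 \<le> (\<Sum>k=1..N. flow z s k)"
      using N adm_pos[OF flow_adm[OF z s(1)]] by (intro member_le_sum) (auto intro: less_imp_le)
    then have "u (flow z s) \<noteq> {}" using s index_empty[of "flow z s"] by simp
    then show ?thesis using s by blast
  qed
  ultimately show "\<exists>S>0. u (flow z S) \<noteq> {} \<and> (\<forall>s. 0 \<le> s \<longrightarrow> s < S \<longrightarrow> u (flow z s) = {})"
    by (intro first_hit z u0) auto
qed

lemma rot_rank_bij: "bij_betw rot_rank {1..N} {1..N}"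
  by (rule bij_betwI[where g = "\<lambda>n. if n = N then 1 else n + 1"]) (use N in \<open>auto simp: rot_rank_def\<close>)

lemma steady_level_1: "steady_level M 1 = M"
  using N by (simp add: steady_level_def)

text \<open>With \<open>steady_level_pred\<close> this says that cutting the top level and rotating
  the ranks leaves every level exactly one gap below that of its new rank.\<close>

lemma steady_level_N: "steady_level M N = b powr (1 - \<gamma>) * M + gap M"
  using N by (simp add: steady_level_def gap_def field_simps)

lemma steady_level_pred: "2 \<le> n \<Longrightarrow> n \<le> N \<Longrightarrow> steady_level M (n - 1) = steady_level M n + gap M"
  by (simp add: steady_level_def gap_def of_nat_diff field_simps)

lemma steady_level_pos: "0 < M \<Longrightarrow> 0 < steady_level M n"
  unfolding steady_level_def using bpow by (intro mult_pos_pos add_pos_nonneg) auto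

lemma steady_level_le: "0 \<le> M \<Longrightarrow> 2 \<le> n \<Longrightarrow> n \<le> N \<Longrightarrow> steady_level M n \<le> M - gap M"
proof -
  assume M: "0 \<le> M" and n: "2 \<le> n" "n \<le> N"
  have "real (N - n + 1) / real N \<le> 1 - 1 / real N"
    using n by (simp add: of_nat_diff field_simps)
  then have "M * (b powr (1 - \<gamma>) + real (N - n + 1) / real N * (1 - b powr (1 - \<gamma>)))
      \<le> M * (b powr (1 - \<gamma>) + (1 - 1 / real N) * (1 - b powr (1 - \<gamma>)))"
    using M bpow by (intro mult_left_mono add_left_mono mult_right_mono) auto
  also have "\<dots> = M - gap M" using N by (simp add: gap_def field_simps)
  finally show ?thesis by (simp add: steady_level_def)
qed

context
  fixes M :: real
  assumes M: "0 < M" and sum_v: "(\<Sum>n=1..N. steady_level M n powr (1 / (1 - \<gamma>))) = C"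
begin

lemma sum_v_perm: "bij_betw \<pi> {1..N} {1..N} \<Longrightarrow> (\<Sum>k=1..N. steady_level M (\<pi> k) powr (1 / (1 - \<gamma>))) = C"
  using sum.reindex_bij_betw[of \<pi> "{1..N}" "{1..N}" "\<lambda>n. steady_level M n powr (1 / (1 - \<gamma>))"] sum_v by simp

text \<open>If all deviations are negative, each rate is below the steady rate of its rank, and
  those sum to \<open>C\<close> under any permutation.\<close>

lemma near_sum_less:
  assumes z: "adm N z" and near: "near M z \<pi> lo hi" and "hi < 0"
  shows "(\<Sum>k=1..N. z k) < C"
proof -
  have "(\<Sum>k=1..N. z k) < (\<Sum>k=1..N. steady_level M (\<pi> k) powr (1 / (1 - \<gamma>)))"
  proof (rule sum_strict_mono)
    fix k assume k: "k \<in> {1..N}"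
    have "z k powr (1 - \<gamma>) < steady_level M (\<pi> k)" using near k \<open>hi < 0\<close> by (force simp: near_def)
    then have "(z k powr (1 - \<gamma>)) powr (1 / (1 - \<gamma>)) < steady_level M (\<pi> k) powr (1 / (1 - \<gamma>))"
      using g by (intro powr_less_mono2) auto
    then show "z k < steady_level M (\<pi> k) powr (1 / (1 - \<gamma>))" using powr_root adm_pos[OF z k] by simp
  qed (use N in auto)
  then show ?thesis using sum_v_perm near by (simp add: near_def)
qed

lemma near_sum_greater:
  assumes z: "adm N z" and near: "near M z \<pi> lo hi" and "0 < lo"
  shows "C < (\<Sum>k=1..N. z k)"
proof -
  have "(\<Sum>k=1..N. steady_level M (\<pi> k) powr (1 / (1 - \<gamma>))) < (\<Sum>k=1..N. z k)"
  proof (rule sum_strict_mono)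
    fix k assume k: "k \<in> {1..N}"
    have "steady_level M (\<pi> k) < z k powr (1 - \<gamma>)" using near k \<open>0 < lo\<close> by (force simp: near_def)
    then have "steady_level M (\<pi> k) powr (1 / (1 - \<gamma>)) < (z k powr (1 - \<gamma>)) powr (1 / (1 - \<gamma>))"
      using g steady_level_pos[OF M, of "\<pi> k"] by (intro powr_less_mono2) auto
    then show "steady_level M (\<pi> k) powr (1 / (1 - \<gamma>)) < z k" using powr_root adm_pos[OF z k] by simp
  qed (use N in auto)
  then show ?thesis using sum_v_perm near by (simp add: near_def)
qed

lemma near_flow: "adm N z \<Longrightarrow> 0 \<le> s \<Longrightarrow> near M z \<pi> lo hi \<Longrightarrow>
    near M (flow z s) \<pi> (lo + (1 - \<gamma>) * a * s) (hi + (1 - \<gamma>) * a * s)"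
  by (auto simp: near_def flow_powr)

text \<open>A range of deviations narrower than one gap forces the largest rate to have rank 1.
  After rotation of the ranks every uncut deviation moves by exactly \<open>- gap M\<close>, and the
  scaled one stays in the shifted range because \<open>lo\<close> and \<open>hi\<close> enclose
  0.\<close>

lemma near_jump:
  assumes z: "adm N z" and near: "near M z \<pi> lo hi" and lh: "lo \<le> 0" "0 \<le> hi" "hi - lo < gap M"
    and ge: "C \<le> (\<Sum>k=1..N. z k)"
  shows "\<exists>j\<in>{1..N}. u z = {j} \<and> M + lo \<le> z j powr (1 - \<gamma>) \<and> z j powr (1 - \<gamma>) \<le> M + hi \<and>
    near M (impulse b (u z) z) (rot_rank \<circ> \<pi>) (lo - gap M) (hi - gap M) \<and>
    post_state b u z = impulse b (u z) z"
proof -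
  have bij: "bij_betw \<pi> {1..N} {1..N}" using near by (simp add: near_def)
  have lower: "steady_level M (\<pi> k) + lo \<le> z k powr (1 - \<gamma>)" and upper: "z k powr (1 - \<gamma>) \<le> steady_level M (\<pi> k) + hi"
    if "k \<in> {1..N}" for k using near that by (auto simp: near_def)
  have \<pi>: "\<pi> k \<in> {1..N}" if "k \<in> {1..N}" for k using bij that by (auto simp: bij_betw_def)
  obtain j where j: "j \<in> {1..N}" "u z = {j}" "\<forall>i\<in>{1..N}. z i \<le> z j" using index_max[OF z ge] by blast
  have "1 \<in> \<pi> ` {1..N}" using bij N by (auto simp: bij_betw_def)
  then obtain i where i: "i \<in> {1..N}" "\<pi> i = 1" by (metis imageE)
  \<comment> \<open>Any other rank lies at or below \<open>M - gap M + hi\<close>, which is less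
    than \<open>M + lo\<close>.\<close>
  have top: "\<pi> j = 1"
  proof (rule ccontr)
    assume "\<pi> j \<noteq> 1"
    then have "steady_level M (\<pi> j) \<le> M - gap M" using \<pi>[OF j(1)] M by (intro steady_level_le) auto
    then have "z j powr (1 - \<gamma>) < z i powr (1 - \<gamma>)"
      using upper[OF j(1)] lower[OF i(1)] lh i steady_level_1 by simp
    moreover have "z i powr (1 - \<gamma>) \<le> z j powr (1 - \<gamma>)"
      using j i adm_pos[OF z i(1)] g by (intro powr_mono2) auto
    ultimately show False by simp
  qed
  have other: "2 \<le> \<pi> k" if "k \<in> {1..N}" "k \<noteq> j" for k
  proof -
    have "\<pi> k \<noteq> \<pi> j" using inj_on_eq_iff[OF bij_betw_imp_inj_on[OF bij] that(1) j(1)] that by simp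
    then show ?thesis using top \<pi>[OF that(1)] by auto
  qed
  have nj: "near M (impulse b (u z) z) (rot_rank \<circ> \<pi>) (lo - gap M) (hi - gap M)"
    unfolding near_def
  proof (intro conjI ballI)
    show "bij_betw (rot_rank \<circ> \<pi>) {1..N} {1..N}" using bij rot_rank_bij by (rule bij_betw_trans)
    fix k assume k: "k \<in> {1..N}"
    have "steady_level M ((rot_rank \<circ> \<pi>) k) + (lo - gap M) \<le> impulse b (u z) z k powr (1 - \<gamma>) \<and>
      impulse b (u z) z k powr (1 - \<gamma>) \<le> steady_level M ((rot_rank \<circ> \<pi>) k) + (hi - gap M)"
    proof (cases "k = j")
      case True
      have "b powr (1 - \<gamma>) * (M + lo) \<le> b powr (1 - \<gamma>) * z j powr (1 - \<gamma>)"
        "b powr (1 - \<gamma>) * z j powr (1 - \<gamma>) \<le> b powr (1 - \<gamma>) * (M + hi)"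
        using lower[OF j(1)] upper[OF j(1)] top steady_level_1 bpow by (auto intro!: mult_left_mono)
      \<comment> \<open>Here the signs enter: a factor below 1 moves \<open>lo\<close> and
        \<open>hi\<close> towards 0.\<close>
      moreover have "b powr (1 - \<gamma>) * hi \<le> hi" "lo \<le> b powr (1 - \<gamma>) * lo"
        using bpow lh by (auto simp: mult_le_cancel_right1 mult_le_cancel_right2)
      ultimately show ?thesis
        using True j top steady_level_N[of M] b by (simp add: impulse_def rot_rank_def powr_mult algebra_simps)
    next
      case False
      then show ?thesis
        using other[OF k False] \<pi>[OF k] steady_level_pred[of "\<pi> k" M] lower[OF k] upper[OF k] j
        by (simp add: impulse_def rot_rank_def)
    qed
    then show "steady_level M ((rot_rank \<circ> \<pi>) k) + (lo - gap M) \<le> impulse b (u z) z k powr (1 - \<gamma>)"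
      "impulse b (u z) z k powr (1 - \<gamma>) \<le> steady_level M ((rot_rank \<circ> \<pi>) k) + (hi - gap M)" by auto
  qed
  \<comment> \<open>Since \<open>hi \<le> hi - lo < gap M\<close>, all deviations are negative after
    one round.\<close>
  have "u (impulse b (u z) z) = {}"
    unfolding index_empty using near_sum_less[OF imp_adm[OF z] nj] lh by simp
  then have "post_state b u z = impulse b (u z) z"
    using j by (intro post_one[where u = u]) auto
  then show ?thesis
    using j nj lower[OF j(1)] upper[OF j(1)] top steady_level_1 by auto
qed

text \<open>The flow and the rotation only shift the range of deviations, so its width stays at most
  \<omega>. Every impulse after time 0 occurs with sum exactly \<open>C\<close>, where the range
  contains 0; the peak is then within \<omega> of \<open>M\<close>, and \<open>time_average\<close>
  applies to each user.\<close>

lemma index_J: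
  assumes \<omega>: "0 < \<omega>" "\<omega> < gap M" and \<kappa>: "0 \<le> \<kappa>"
    and x: "\<And>k. k \<in> {1..N} \<Longrightarrow> 0 < x k"
    and near0: "\<And>k. k \<in> {1..N} \<Longrightarrow> \<bar>x k powr (1 - \<gamma>) - steady_level M k\<bar> \<le> \<omega> / 2"
    and gain: "\<And>y. 0 < y \<Longrightarrow> \<bar>y powr (1 - \<gamma>) - M\<bar> \<le> \<omega> \<Longrightarrow> \<bar>gain \<alpha> y - L\<bar> \<le> \<kappa>"
  shows "\<exists>r. J a b \<gamma> \<alpha> (index_policy b \<gamma> \<alpha> tie) x C N = ereal r \<and> \<bar>r - real N * L\<bar> \<le> real N * \<kappa>"
proof -
  interpret gaimd_policy a b \<gamma> N u "C / real N" by (rule index_gaimd_policy)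
  define X where "X = trajectory a b \<gamma> u N x"
  have X: "is_trajectory a b \<gamma> u N x X" unfolding X_def by (rule trajectory[OF x])
  have X_adm: "adm N (X t)" if "0 \<le> t" for t using traj_adm[OF X that] .
  have up: "(\<Sum>k=1..N. X t k) \<le> C" if "0 < t" for t
  proof (rule tendsto_upperbound)
    show "((\<lambda>s. \<Sum>k=1..N. X s k) \<longlongrightarrow> (\<Sum>k=1..N. X t k)) (at_left t)"
      using traj_tendsto_left[OF X that] by (rule tendsto_sum)
    show "\<forall>\<^sub>F s in at_left t. (\<Sum>k=1..N. X s k) \<le> C"
      using traj_left[OF X that] by (rule eventually_mono) (simp add: index_empty)
  qed simp
  \<comment> \<open>At a positive impulse time the sum equals \<open>C\<close>, which deviations of
    one strict sign would contradict.\<close>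
  have sign: "lo \<le> 0 \<and> 0 \<le> hi" if "0 < t" "u (X t) \<noteq> {}" "near M (X t) \<pi> lo hi" for t \<pi> lo hi
    using near_sum_less[OF X_adm that(3)] near_sum_greater[OF X_adm that(3)] up[OF that(1)] that(1,2)
      index_empty[of "X t"] by (auto simp: not_less[symmetric])
  define P where "P t \<longleftrightarrow> (\<exists>\<pi> lo hi. hi - lo \<le> \<omega> \<and> near M (X t) \<pi> lo hi)" for t
  have P: "P t" if "0 < t" for t
  proof (rule traj_induct[OF X that])
    fix t' t :: real
    assume t: "0 \<le> t'" "t' < t" and cas: "t' = 0 \<or> P t' \<and> u (X t') \<noteq> {}"
      and fl: "\<And>s. t' < s \<Longrightarrow> s \<le> t \<Longrightarrow> X s = flow (post_state b u (X t')) (s - t')"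
    \<comment> \<open>At time 0 the sum may exceed \<open>C\<close>, so there the signs come from
      the symmetric initial range instead.\<close>
    have "\<exists>\<pi> lo hi. hi - lo \<le> \<omega> \<and> near M (X t') \<pi> lo hi \<and> (u (X t') \<noteq> {} \<longrightarrow> lo \<le> 0 \<and> 0 \<le> hi)"
    proof (cases "t' = 0")
      case True
      have "near M (X 0) (\<lambda>k. k) (- (\<omega> / 2)) (\<omega> / 2)"
        unfolding near_def
      proof (intro conjI ballI)
        fix k assume k: "k \<in> {1..N}"
        have "X 0 k = x k"
          by (rule bspec[OF conjunct1[OF X[unfolded is_trajectory_def]] k])
        then have "\<bar>X 0 k powr (1 - \<gamma>) - steady_level M k\<bar> \<le> \<omega> / 2" using near0[OF k] by simp
        then show "steady_level M k + - (\<omega> / 2) \<le> X 0 k powr (1 - \<gamma>)" "X 0 k powr (1 - \<gamma>) \<le> steady_level M k + \<omega> / 2"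
          by linarith+
      qed (auto simp: bij_betw_def)
      then show ?thesis using \<omega> True by (intro exI conjI) auto
    next
      case False
      then show ?thesis using cas sign t unfolding P_def by (metis less_eq_real_def)
    qed
    then obtain \<pi> lo hi where n: "hi - lo \<le> \<omega>" "near M (X t') \<pi> lo hi" "u (X t') \<noteq> {} \<Longrightarrow> lo \<le> 0 \<and> 0 \<le> hi"
      by blast
    have "\<exists>\<pi> lo hi. hi - lo \<le> \<omega> \<and> near M (post_state b u (X t')) \<pi> lo hi"
    proof (cases "u (X t') = {}")
      case True
      then show ?thesis using n post_none[of u] by auto
    next
      case False
      then have "near M (post_state b u (X t')) (rot_rank \<circ> \<pi>) (lo - gap M) (hi - gap M)"
        using near_jump[OF X_adm[OF t(1)] n(2)] n(1,3) \<omega> index_empty[of "X t'"] by auto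
      then show ?thesis using n(1) by (intro exI conjI) auto
    qed
    then obtain \<pi> lo hi where "hi - lo \<le> \<omega>" "near M (post_state b u (X t')) \<pi> lo hi" by blast
    moreover from this have "near M (X t) \<pi> (lo + (1 - \<gamma>) * a * (t - t')) (hi + (1 - \<gamma>) * a * (t - t'))"
      using near_flow[OF post_adm[OF X_adm[OF t(1)], of u], of "t - t'"] fl[of t] t by simp
    ultimately show "P t" unfolding P_def by (intro exI conjI) auto
  qed
  have peak: "post_state b u (X t) = imp u (X t) \<and> (k \<in> u (X t) \<longrightarrow> \<bar>X t k powr (1 - \<gamma>) - M\<bar> \<le> \<omega>)"
    if t: "0 < t" "u (X t) \<noteq> {}" for t k
  proof -
    obtain \<pi> lo hi where n: "hi - lo \<le> \<omega>" "near M (X t) \<pi> lo hi" using P[OF t(1)] unfolding P_def by blast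
    have lh: "lo \<le> 0" "0 \<le> hi" using sign[OF t n(2)] by auto
    obtain j where "u (X t) = {j}" "M + lo \<le> X t j powr (1 - \<gamma>)" "X t j powr (1 - \<gamma>) \<le> M + hi"
      "post_state b u (X t) = imp u (X t)"
      using near_jump[OF X_adm n(2) lh] n(1) \<omega> t index_empty[of "X t"] by auto
    then show ?thesis using n lh by (auto simp: abs_le_iff)
  qed
  \<comment> \<open>Keeps \<open>M - \<omega>\<close> positive, which yields the positive lower
    bound on the peaks.\<close>
  have gap_le: "gap M \<le> M"
  proof -
    have "(1 - b powr (1 - \<gamma>)) / real N \<le> 1"
      by (rule divide_le_eq_1_pos[THEN iffD2]) (use bpow N in linarith)+
    then have "M * ((1 - b powr (1 - \<gamma>)) / real N) \<le> M" using M by (intro mult_left_le) auto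
    then show ?thesis by (simp add: gap_def)
  qed
  have "\<exists>l. Liminf at_top (\<lambda>\<tau>. ereal (1 / \<tau> * integral {0..\<tau>} (\<lambda>t. X t k powr (1 - \<alpha>) / (1 - \<alpha>)))) = ereal l
      \<and> \<bar>l - L\<bar> \<le> \<kappa>" if k: "k \<in> {1..N}" for k
  proof (rule time_average[OF X k \<alpha>(2,3)])
    show "post_state b u (X t) = impulse b (u (X t)) (X t)" if "0 < t" "u (X t) \<noteq> {}" for t
      using peak[OF that] by blast
    show "(M - \<omega>) powr (1 / (1 - \<gamma>)) \<le> X t k \<and> \<bar>gain \<alpha> (X t k) - L\<bar> \<le> \<kappa>" if t: "0 < t" "k \<in> u (X t)" for t
    proof -
      have pos: "0 < X t k" using adm_pos[OF X_adm k] t by simp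
      have p: "\<bar>X t k powr (1 - \<gamma>) - M\<bar> \<le> \<omega>" using peak[of t k] t by auto
      then have "(M - \<omega>) powr (1 / (1 - \<gamma>)) \<le> (X t k powr (1 - \<gamma>)) powr (1 / (1 - \<gamma>))"
        using g gap_le \<omega> by (intro powr_mono2) auto
      then show ?thesis using gain[OF pos p] powr_root[OF pos] by simp
    qed
    show "0 < (M - \<omega>) powr (1 / (1 - \<gamma>))" using gap_le \<omega> by simp
    show "0 \<le> \<kappa>" by (rule \<kappa>)
    show "X t k \<le> C" if t: "0 < t" for t
    proof -
      have "X t k \<le> (\<Sum>k=1..N. X t k)"
        using k adm_pos[OF X_adm] t by (intro member_le_sum) (auto intro: less_imp_le)
      then show ?thesis using up[OF t] by simp
    qed
  qed
  then obtain l where l: "\<forall>k\<in>{1..N}.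
      Liminf at_top (\<lambda>\<tau>. ereal (1 / \<tau> * integral {0..\<tau>} (\<lambda>t. X t k powr (1 - \<alpha>) / (1 - \<alpha>)))) = ereal (l k)
      \<and> \<bar>l k - L\<bar> \<le> \<kappa>"
    by (rule bchoice[OF ballI, THEN exE])
  have "J a b \<gamma> \<alpha> (index_policy b \<gamma> \<alpha> tie) x C N = ereal (\<Sum>k=1..N. l k)"
    unfolding J_def u_def[symmetric] X_def[symmetric] using l by simp
  moreover have "\<bar>(\<Sum>k=1..N. l k) - real N * L\<bar> \<le> real N * \<kappa>"
  proof -
    have "(\<Sum>k=1..N. l k) - real N * L = (\<Sum>k=1..N. l k - L)" by (simp add: sum_subtractf)
    also have "\<bar>\<dots>\<bar> \<le> (\<Sum>k=1..N. \<kappa>)" using l by (intro order_trans[OF sum_abs] sum_mono) auto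
    finally show ?thesis by simp
  qed
  ultimately show ?thesis by blast
qed

end

end

end

subsection \<open>The limit of the steady state\<close>

text \<open>By the mean value theorem each increment of \<open>F\<close> lies between the left and
  the right rectangle; the difference of the two sums telescopes to
  \<open>(f 1 - f 0) / real n\<close>.\<close>

lemma riemann_sum_bounds:
  fixes F f :: "real \<Rightarrow> real"
  assumes der: "\<And>t. 0 \<le> t \<Longrightarrow> t \<le> 1 \<Longrightarrow> (F has_real_derivative f t) (at t)"
    and mono: "\<And>s t. 0 \<le> s \<Longrightarrow> s \<le> t \<Longrightarrow> t \<le> 1 \<Longrightarrow> f s \<le> f t" and n: "0 < n"
  shows "F 1 - F 0 \<le> (\<Sum>i=1..n. f (real i / real n)) / real n"
    and "(\<Sum>i=1..n. f (real i / real n)) / real n \<le> F 1 - F 0 + (f 1 - f 0) / real n"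
proof -
  let ?x = "\<lambda>i. real i / real n"
  have step: "f (?x i) / real n \<le> F (?x (Suc i)) - F (?x i) \<and> F (?x (Suc i)) - F (?x i) \<le> f (?x (Suc i)) / real n"
    if i: "i < n" for i
  proof -
    have lt: "?x i < ?x (Suc i)" "0 \<le> ?x i" "?x (Suc i) \<le> 1" "?x (Suc i) - ?x i = 1 / real n"
      using i n by (auto simp: field_simps)
    obtain z where z: "?x i < z" "z < ?x (Suc i)" "F (?x (Suc i)) - F (?x i) = (?x (Suc i) - ?x i) * f z"
    proof -
      have "(F has_real_derivative f t) (at t)" if "?x i \<le> t" "t \<le> ?x (Suc i)" for t
        using that lt(2,3) by (intro der) linarith+
      from MVT2[OF lt(1) this] show ?thesis using that by blast
    qed
    have "f (?x i) \<le> f z" "f z \<le> f (?x (Suc i))" by (rule mono; use z(1,2) lt(2,3) in linarith)+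
    then show ?thesis unfolding z(3) lt(4) by (auto simp: divide_right_mono)
  qed
  have tel: "(\<Sum>i<n. F (?x (Suc i)) - F (?x i)) = F 1 - F 0"
    using sum_lessThan_telescope[of "\<lambda>i. F (?x i)" n] n by simp
  have telf: "(\<Sum>i<n. f (?x (Suc i)) - f (?x i)) = f 1 - f 0"
    using sum_lessThan_telescope[of "\<lambda>i. f (?x i)" n] n by simp
  have eq: "(\<Sum>i=1..n. f (?x i)) / real n = (\<Sum>i<n. f (?x (Suc i)) / real n)"
    by (simp add: sum.atLeast1_atMost_eq sum_divide_distrib)
  show "F 1 - F 0 \<le> (\<Sum>i=1..n. f (?x i)) / real n"
    unfolding tel[symmetric] eq using step by (intro sum_mono) auto
  have "(\<Sum>i<n. f (?x (Suc i)) / real n) - (f 1 - f 0) / real n = (\<Sum>i<n. f (?x i) / real n)"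
    unfolding telf[symmetric] sum_divide_distrib sum_subtractf[symmetric] by (simp add: diff_divide_distrib)
  also have "\<dots> \<le> F 1 - F 0"
    unfolding tel[symmetric] using step by (intro sum_mono) auto
  finally show "(\<Sum>i=1..n. f (?x i)) / real n \<le> F 1 - F 0 + (f 1 - f 0) / real n"
    unfolding eq by simp
qed

lemma riemann_sum_tendsto:
  fixes F f :: "real \<Rightarrow> real"
  assumes "\<And>t. 0 \<le> t \<Longrightarrow> t \<le> 1 \<Longrightarrow> (F has_real_derivative f t) (at t)"
    and "\<And>s t. 0 \<le> s \<Longrightarrow> s \<le> t \<Longrightarrow> t \<le> 1 \<Longrightarrow> f s \<le> f t"
  shows "(\<lambda>n. (\<Sum>i=1..n. f (real i / real n)) / real n) \<longlonglongrightarrow> F 1 - F 0"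
proof (rule tendsto_sandwich)
  show "\<forall>\<^sub>F n in sequentially. F 1 - F 0 \<le> (\<Sum>i=1..n. f (real i / real n)) / real n"
    using eventually_gt_at_top[of 0] by (rule eventually_mono) (rule riemann_sum_bounds[OF assms])
  show "\<forall>\<^sub>F n in sequentially. (\<Sum>i=1..n. f (real i / real n)) / real n \<le> F 1 - F 0 + (f 1 - f 0) / real n"
    using eventually_gt_at_top[of 0] by (rule eventually_mono) (rule riemann_sum_bounds[OF assms])
  have "(\<lambda>n. F 1 - F 0 + (f 1 - f 0) / real n) \<longlonglongrightarrow> F 1 - F 0 + 0"
    by (intro tendsto_intros lim_const_over_n)
  then show "(\<lambda>n. F 1 - F 0 + (f 1 - f 0) / real n) \<longlonglongrightarrow> F 1 - F 0" by simp
qed simp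

lemma threshold_scale: "1 \<le> N \<Longrightarrow> threshold b \<gamma> (c * real N) N = threshold b \<gamma> c 1"
  by (simp add: threshold_def)

text \<open>With capacity \<open>c * real N\<close>, \<open>steady_max\<close> is \<open>c\<close>
  divided by a Riemann sum of \<open>(\<beta> + t * (1 - \<beta>)) powr q\<close> on the unit
  interval. The primitive \<open>F\<close> evaluates the integral, which gives the
  threshold.\<close>

lemma steady_max_tendsto:
  fixes b c \<gamma> :: real
  assumes b: "0 < b" "b < 1" and g: "\<gamma> < 1"
  shows "(\<lambda>N. steady_max b \<gamma> (c * real N) N) \<longlonglongrightarrow> threshold b \<gamma> c 1"
proof -
  define \<beta> where "\<beta> = b powr (1 - \<gamma>)"
  define q where "q = 1 / (1 - \<gamma>)"
  define f where "f t = (\<beta> + t * (1 - \<beta>)) powr q" for t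
  define F where "F t = (\<beta> + t * (1 - \<beta>)) powr (q + 1) / ((q + 1) * (1 - \<beta>))" for t
  have \<beta>: "0 < \<beta>" "\<beta> < 1" using b g powr_less_mono2[of "1 - \<gamma>" b 1] by (auto simp: \<beta>_def)
  have q: "0 < q" using g by (simp add: q_def)
  have pos: "0 < \<beta> + t * (1 - \<beta>)" if "0 \<le> t" for t using that \<beta> by (intro add_pos_nonneg) auto
  have "(\<lambda>n. (\<Sum>i=1..n. f (real i / real n)) / real n) \<longlonglongrightarrow> F 1 - F 0"
  proof (rule riemann_sum_tendsto)
    fix t :: real assume t: "0 \<le> t"
    have "((\<lambda>t. (\<beta> + t * (1 - \<beta>)) powr (q + 1)) has_real_derivative
        ((q + 1) * (\<beta> + t * (1 - \<beta>)) powr (q + 1 - 1)) * (1 - \<beta>)) (at t)"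
      by (rule DERIV_chain2[where f = "\<lambda>x. x powr (q + 1)" and g = "\<lambda>t. \<beta> + t * (1 - \<beta>)",
            OF has_real_derivative_powr[OF pos[OF t]]])
        (auto intro!: derivative_eq_intros)
    from DERIV_cdivide[OF this, of "(q + 1) * (1 - \<beta>)"] show "(F has_real_derivative f t) (at t)"
      unfolding F_def f_def using q \<beta> by simp
  next
    fix s t :: real assume "0 \<le> s" "s \<le> t"
    then show "f s \<le> f t" unfolding f_def using pos[of s] q \<beta>
      by (intro powr_mono2 add_left_mono mult_right_mono) auto
  qed
  moreover have "F 1 - F 0 = (1 - \<beta> powr (q + 1)) / ((q + 1) * (1 - \<beta>))"
    by (simp add: F_def diff_divide_distrib)
  ultimately have lim: "(\<lambda>n. (\<Sum>i=1..n. f (real i / real n)) / real n) \<longlonglongrightarrow>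
      (1 - \<beta> powr (q + 1)) / ((q + 1) * (1 - \<beta>))" by (simp only:)
  have "(1 - \<beta> powr (q + 1)) / ((q + 1) * (1 - \<beta>)) \<noteq> 0"
    using \<beta> q powr_less_mono2[of "q + 1" \<beta> 1] by auto
  from tendsto_divide[OF tendsto_const lim this]
  have "(\<lambda>n. c / ((\<Sum>i=1..n. f (real i / real n)) / real n)) \<longlonglongrightarrow>
      c / ((1 - \<beta> powr (q + 1)) / ((q + 1) * (1 - \<beta>)))" .
  moreover have "c / ((1 - \<beta> powr (q + 1)) / ((q + 1) * (1 - \<beta>))) = threshold b \<gamma> c 1"
  proof -
    have "(1 - \<gamma>) * (q + 1) = 2 - \<gamma>" using g by (simp add: q_def distrib_left)
    then have "\<beta> powr (q + 1) = b powr (2 - \<gamma>)" by (simp add: \<beta>_def powr_powr)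
    moreover have "q + 1 = (2 - \<gamma>) / (1 - \<gamma>)" using g by (simp add: q_def field_simps)
    ultimately show ?thesis by (simp add: threshold_def \<beta>_def mult_ac)
  qed
  ultimately show ?thesis
    unfolding steady_max_def f_def \<beta>_def q_def by simp
qed

section \<open>Euclidean neighbourhoods of the steady state\<close>

context gaimd
begin

text \<open>The radius is fixed before \<kappa> and \<open>L\<close>, since one radius per
  \<open>N\<close> has to serve all accuracies. Continuity of the power turns closeness of rates
  into deviations of at most a quarter of the gap, hence a range of width at most half a
  gap.\<close>

lemma index_J_near_steady:
  assumes \<alpha>: "0 < \<alpha>" "\<alpha> \<noteq> 1" "2 - \<alpha> - \<gamma> \<noteq> 0" and N: "1 \<le> N" and C: "0 < C"
    and tie: "\<And>N x S. S \<noteq> {} \<Longrightarrow> tie N x S \<in> S"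
  defines "M \<equiv> steady_max b \<gamma> C N powr (1 - \<gamma>)"
  shows "\<exists>\<epsilon>>0. \<forall>x. (\<forall>k\<in>{1..N}. 0 < x k) \<and> L2_set (\<lambda>k. x k - steady_state b \<gamma> C N k) {1..N} < \<epsilon> \<longrightarrow>
    (\<forall>\<kappa>\<ge>0. \<forall>L. (\<forall>y>0. \<bar>y powr (1 - \<gamma>) - M\<bar> \<le> gap M / 2 \<longrightarrow> \<bar>gain \<alpha> y - L\<bar> \<le> \<kappa>) \<longrightarrow>
      (\<exists>r. J a b \<gamma> \<alpha> (index_policy b \<gamma> \<alpha> tie) x C N = ereal r \<and> \<bar>r - real N * L\<bar> \<le> real N * \<kappa>))"
proof -
  define w where "w n = b powr (1 - \<gamma>) + real (N - n + 1) / real N * (1 - b powr (1 - \<gamma>))" for n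
  define sm where "sm = steady_max b \<gamma> C N"
  define s where "s = steady_state b \<gamma> C N"
  have w: "0 < w n" for n unfolding w_def using bpow by (intro add_pos_nonneg) auto
  \<comment> \<open>Reversal of the order of summation: \<open>steady_max\<close> counts from the
    smallest rate, ranks count from the largest.\<close>
  have sum_w: "(\<Sum>i=1..N. (b powr (1 - \<gamma>) + real i / real N * (1 - b powr (1 - \<gamma>))) powr (1 / (1 - \<gamma>)))
      = (\<Sum>n=1..N. w n powr (1 / (1 - \<gamma>)))"
    unfolding w_def by (subst sum.atLeastAtMost_rev) (auto intro!: sum.cong simp: of_nat_diff Suc_diff_le)
  have sum_pos: "0 < (\<Sum>n=1..N. w n powr (1 / (1 - \<gamma>)))"
    using w N by (intro Groups_Big.sum_pos) (auto simp: less_imp_neq[symmetric])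
  have sm_eq: "sm = C / (\<Sum>n=1..N. w n powr (1 / (1 - \<gamma>)))"
    unfolding sm_def steady_max_def sum_w by simp
  have sm: "0 < sm" unfolding sm_eq using C sum_pos by simp
  have M: "0 < M" using sm by (simp add: M_def sm_def)
  have v: "steady_level M n = sm powr (1 - \<gamma>) * w n" for n by (simp add: steady_level_def M_def sm_def w_def)
  have v_root: "steady_level M n powr (1 / (1 - \<gamma>)) = sm * w n powr (1 / (1 - \<gamma>))" for n
    unfolding v using sm w[of n] powr_root[OF sm] by (simp add: powr_mult)
  have sum_v: "(\<Sum>n=1..N. steady_level M n powr (1 / (1 - \<gamma>))) = C"
    unfolding v_root sum_distrib_left[symmetric] using sum_pos by (simp add: sm_eq)
  have s_root: "s n = steady_level M n powr (1 / (1 - \<gamma>))" for n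
    using N by (auto simp: s_def steady_state_def v_root sm_def w_def)
  have s_pos: "0 < s n" and s_powr: "s n powr (1 - \<gamma>) = steady_level M n" for n
    using sm w[of n] g by (auto simp: s_root v powr_powr)
  have gap: "0 < gap M" using M N bpow by (simp add: gap_def)
  have "\<forall>\<^sub>F \<epsilon> in at_right 0. \<forall>k\<in>{1..N}. \<forall>y. \<bar>y - s k\<bar> < \<epsilon> \<longrightarrow> \<bar>y powr (1 - \<gamma>) - steady_level M k\<bar> \<le> gap M / 4"
  proof (rule eventually_ball_finite, simp, rule ballI)
    fix k
    have "isCont (\<lambda>y. y powr (1 - \<gamma>)) (s k)" using s_pos[of k] by (intro continuous_intros) auto
    then obtain d where d: "0 < d" "\<And>y. \<bar>y - s k\<bar> < d \<Longrightarrow> \<bar>y powr (1 - \<gamma>) - s k powr (1 - \<gamma>)\<bar> < gap M / 4"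
      using gap unfolding continuous_at_eps_delta dist_real_def by (metis divide_pos_pos zero_less_numeral)
    show "\<forall>\<^sub>F \<epsilon> in at_right 0. \<forall>y. \<bar>y - s k\<bar> < \<epsilon> \<longrightarrow> \<bar>y powr (1 - \<gamma>) - steady_level M k\<bar> \<le> gap M / 4"
    proof (rule eventually_at_rightI[OF _ d(1)], intro allI impI)
      fix \<epsilon> y assume "\<epsilon> \<in> {0<..<d}" "\<bar>y - s k\<bar> < \<epsilon>"
      then show "\<bar>y powr (1 - \<gamma>) - steady_level M k\<bar> \<le> gap M / 4" using d(2)[of y] by (simp add: s_powr)
    qed
  qed
  then have "\<forall>\<^sub>F \<epsilon> in at_right 0. 0 < \<epsilon> \<and>
      (\<forall>k\<in>{1..N}. \<forall>y. \<bar>y - s k\<bar> < \<epsilon> \<longrightarrow> \<bar>y powr (1 - \<gamma>) - steady_level M k\<bar> \<le> gap M / 4)"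
    using eventually_at_right_less[of 0] by (rule eventually_conj[rotated])
  from eventually_happens'[OF trivial_limit_at_right_real this] obtain \<epsilon> where \<epsilon>: "0 < \<epsilon>"
    "\<And>k y. k \<in> {1..N} \<Longrightarrow> \<bar>y - s k\<bar> < \<epsilon> \<Longrightarrow> \<bar>y powr (1 - \<gamma>) - steady_level M k\<bar> \<le> gap M / 4"
    by blast
  show ?thesis
  proof (rule exI[of _ \<epsilon>], intro conjI allI impI)
    fix x :: state and \<kappa> L :: real
    assume x: "(\<forall>k\<in>{1..N}. 0 < x k) \<and> L2_set (\<lambda>k. x k - steady_state b \<gamma> C N k) {1..N} < \<epsilon>"
      and \<kappa>: "0 \<le> \<kappa>"
      and gain: "\<forall>y>0. \<bar>y powr (1 - \<gamma>) - M\<bar> \<le> gap M / 2 \<longrightarrow> \<bar>gain \<alpha> y - L\<bar> \<le> \<kappa>"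
    have near0: "\<bar>x k powr (1 - \<gamma>) - steady_level M k\<bar> \<le> (gap M / 2) / 2" if k: "k \<in> {1..N}" for k
    proof -
      have "\<bar>x k - s k\<bar> \<le> L2_set (\<lambda>k. \<bar>x k - s k\<bar>) {1..N}"
        using k by (intro member_le_L2_set) auto
      also have "\<dots> < \<epsilon>" using x by (simp add: L2_set_def s_def)
      finally show ?thesis using \<epsilon>(2)[OF k] by simp
    qed
    show "\<exists>r. J a b \<gamma> \<alpha> (index_policy b \<gamma> \<alpha> tie) x C N = ereal r \<and> \<bar>r - real N * L\<bar> \<le> real N * \<kappa>"
      by (rule index_J[OF \<alpha> N C tie M sum_v _ _ \<kappa> _ near0]) (use gap x gain in auto)
  qed (rule \<epsilon>(1))
qed

end

subsection \<open>Asymptotic optimality\<close>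

theorem theorem4:
  fixes a b c \<gamma> \<alpha> :: real and tie :: "nat \<Rightarrow> state \<Rightarrow> nat set \<Rightarrow> nat"
  assumes "c > 0" and "a > 0" and "0 < b" and "b < 1" and "0 \<le> \<gamma>" and "\<gamma> < 1"
    and "\<alpha> > 0" and "\<alpha> \<noteq> 1" and "2 - \<alpha> - \<gamma> \<noteq> 0"
    and tie_rule: "\<And>N x S. S \<noteq> {} \<Longrightarrow> tie N x S \<in> S"
  shows "\<exists>\<epsilon> :: nat \<Rightarrow> real. (\<forall>N\<ge>1. \<epsilon> N > 0) \<and>
    (\<forall>x :: nat \<Rightarrow> state.
      (\<forall>N\<ge>1. (\<forall>k\<in>{1..N}. 0 < x N k) \<and>
         L2_set (\<lambda>k. x N k - steady_state b \<gamma> (c * real N) N k) {1..N} < \<epsilon> N) \<longrightarrow>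
      (\<exists>L :: real.
        (\<lambda>N. ereal (1 / real N) *
           J a b \<gamma> \<alpha> (index_policy b \<gamma> \<alpha> tie) (x N) (c * real N) N) \<longlonglongrightarrow> ereal L \<and>
        (\<lambda>N. ereal (1 / real N) *
           J a b \<gamma> \<alpha> (threshold_policy b \<gamma>) (x N) (c * real N) N) \<longlonglongrightarrow> ereal L))"
proof -
  have gaimd: "gaimd a b \<gamma>" using assms by (unfold_locales) auto
  let ?gain = "gaimd.gain b \<gamma> \<alpha>"
  define M where "M N = steady_max b \<gamma> (c * real N) N powr (1 - \<gamma>)" for N
  define gp where "gp N = gaimd.gap b \<gamma> N (M N)" for N
  define \<theta> where "\<theta> = threshold b \<gamma> c 1"
  \<comment> \<open>The common limit: the cycle average at the threshold, which does not depend on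
    \<open>N\<close>.\<close>
  define L where "L = ?gain \<theta>"
  have \<theta>: "0 < \<theta>" unfolding \<theta>_def using gaimd.threshold_pos[OF gaimd] assms(1) by simp
  let ?Q = "\<lambda>N \<epsilon>. 0 < \<epsilon> \<and> (\<forall>x. (\<forall>k\<in>{1..N}. 0 < x k) \<and>
      L2_set (\<lambda>k. x k - steady_state b \<gamma> (c * real N) N k) {1..N} < \<epsilon> \<longrightarrow>
    (\<forall>\<kappa>\<ge>0. \<forall>L. (\<forall>y>0. \<bar>y powr (1 - \<gamma>) - M N\<bar> \<le> gp N / 2 \<longrightarrow> \<bar>?gain y - L\<bar> \<le> \<kappa>) \<longrightarrow>
      (\<exists>r. J a b \<gamma> \<alpha> (index_policy b \<gamma> \<alpha> tie) x (c * real N) N = ereal r \<and> \<bar>r - real N * L\<bar> \<le> real N * \<kappa>)))"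
  have "\<exists>\<epsilon>. \<forall>N\<ge>1. ?Q N (\<epsilon> N)"
  proof (rule choice_iff'[THEN iffD1], intro allI impI)
    fix N :: nat assume "1 \<le> N"
    then show "\<exists>\<epsilon>. ?Q N \<epsilon>"
      unfolding M_def gp_def using assms
      by (intro gaimd.index_J_near_steady[OF gaimd]) auto
  qed
  then obtain \<epsilon> where \<epsilon>: "\<And>N. 1 \<le> N \<Longrightarrow> ?Q N (\<epsilon> N)" by blast
  have sm: "(\<lambda>N. steady_max b \<gamma> (c * real N) N) \<longlonglongrightarrow> \<theta>"
    unfolding \<theta>_def by (rule steady_max_tendsto[OF assms(3,4,6)])
  have M: "M \<longlonglongrightarrow> \<theta> powr (1 - \<gamma>)"
    unfolding M_def using \<theta> by (intro tendsto_powr sm tendsto_const) auto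
  \<comment> \<open>The spacing is of order \<open>1 / real N\<close>, so the admissible peaks
    concentrate at \<open>M N\<close>, which tends to
    \<open>\<theta> powr (1 - \<gamma>)\<close>.\<close>
  have "(\<lambda>N. M N * (1 - b powr (1 - \<gamma>)) * (1 / real N)) \<longlonglongrightarrow> \<theta> powr (1 - \<gamma>) * (1 - b powr (1 - \<gamma>)) * 0"
    by (intro tendsto_mult M tendsto_const lim_const_over_n)
  then have gp: "gp \<longlonglongrightarrow> 0"
    unfolding gp_def gaimd.gap_def[OF gaimd] by simp
  show ?thesis
  proof (intro exI[of _ \<epsilon>] conjI allI impI)
    show "0 < \<epsilon> N" if "1 \<le> N" for N using \<epsilon>[OF that] by blast
    fix x :: "nat \<Rightarrow> state"
    assume x: "\<forall>N\<ge>1. (\<forall>k\<in>{1..N}. 0 < x N k) \<and>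
         L2_set (\<lambda>k. x N k - steady_state b \<gamma> (c * real N) N k) {1..N} < \<epsilon> N"
    show "\<exists>L :: real.
        (\<lambda>N. ereal (1 / real N) *
           J a b \<gamma> \<alpha> (index_policy b \<gamma> \<alpha> tie) (x N) (c * real N) N) \<longlonglongrightarrow> ereal L \<and>
        (\<lambda>N. ereal (1 / real N) *
           J a b \<gamma> \<alpha> (threshold_policy b \<gamma>) (x N) (c * real N) N) \<longlonglongrightarrow> ereal L"
    proof (intro exI[of _ L] conjI)
      show "(\<lambda>N. ereal (1 / real N) *
           J a b \<gamma> \<alpha> (threshold_policy b \<gamma>) (x N) (c * real N) N) \<longlonglongrightarrow> ereal L"
      proof (rule tendsto_eventually, rule eventually_mono[OF eventually_ge_at_top[of 1]])
        fix N :: nat assume N: "1 \<le> N"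
        \<comment> \<open>Equality holds for each such \<open>N\<close>, because the threshold
          depends only on the capacity per user.\<close>
        have "J a b \<gamma> \<alpha> (threshold_policy b \<gamma>) (x N) (c * real N) N = ereal (real N * L)"
          using gaimd.threshold_J[OF gaimd N, of "c * real N" \<alpha> "x N"] assms x N
          by (simp add: threshold_scale L_def \<theta>_def)
        then show "ereal (1 / real N) * J a b \<gamma> \<alpha> (threshold_policy b \<gamma>) (x N) (c * real N) N = ereal L"
          using N by simp
      qed
      have near: "\<forall>\<^sub>F N in sequentially. \<exists>r. ereal (1 / real N) *
          J a b \<gamma> \<alpha> (index_policy b \<gamma> \<alpha> tie) (x N) (c * real N) N = ereal r \<and> \<bar>r - L\<bar> \<le> \<kappa>"
        if \<kappa>: "0 < \<kappa>" for \<kappa>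
      proof -
        \<comment> \<open>The gain is viewed as a function of \<open>x powr (1 - \<gamma>)\<close>,
          the coordinate in which the peaks are controlled.\<close>
        have "isCont (\<lambda>w. ?gain (w powr (1 / (1 - \<gamma>)))) (\<theta> powr (1 - \<gamma>))"
          unfolding gaimd.gain_def[OF gaimd] using \<theta> by (intro continuous_intros) auto
        then obtain d where d: "0 < d" "\<And>w. \<bar>w - \<theta> powr (1 - \<gamma>)\<bar> < d \<Longrightarrow>
            \<bar>?gain (w powr (1 / (1 - \<gamma>))) - ?gain ((\<theta> powr (1 - \<gamma>)) powr (1 / (1 - \<gamma>)))\<bar> < \<kappa>"
          using \<kappa> unfolding continuous_at_eps_delta dist_real_def by metis
        have "\<forall>\<^sub>F N in sequentially. \<bar>M N - \<theta> powr (1 - \<gamma>)\<bar> < d / 2"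
          using tendstoD[OF M, of "d / 2"] d by (simp add: dist_real_def)
        moreover have "\<forall>\<^sub>F N in sequentially. \<bar>gp N\<bar> < d / 2"
          using tendstoD[OF gp, of "d / 2"] d by (simp add: dist_real_def)
        ultimately show ?thesis
          using eventually_ge_at_top[of 1]
        proof eventually_elim
          case (elim N)
          have "\<bar>?gain y - L\<bar> \<le> \<kappa>" if y: "0 < y" "\<bar>y powr (1 - \<gamma>) - M N\<bar> \<le> gp N / 2" for y
          proof -
            \<comment> \<open>\<open>M N\<close> contributes less than \<open>d / 2\<close> and the
              half gap less than \<open>d / 4\<close>.\<close>
            have "\<bar>y powr (1 - \<gamma>) - \<theta> powr (1 - \<gamma>)\<bar> < d" using y elim by linarith
            from d(2)[OF this] show ?thesis
              unfolding gaimd.powr_root[OF gaimd y(1)] gaimd.powr_root[OF gaimd \<theta>] L_def by simp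
          qed
          then obtain r where r: "J a b \<gamma> \<alpha> (index_policy b \<gamma> \<alpha> tie) (x N) (c * real N) N = ereal r"
            "\<bar>r - real N * L\<bar> \<le> real N * \<kappa>"
            using \<epsilon>[OF elim(3)] x elim(3) \<kappa> less_imp_le by blast
          have "r / real N - L = (r - real N * L) / real N" using elim(3) by (simp add: field_simps)
          then have "\<bar>r / real N - L\<bar> \<le> \<kappa>" using r(2) elim(3) by (simp add: divide_le_eq mult.commute)
          then show ?case using r(1) by (intro exI[of _ "r / real N"]) auto
        qed
      qed
      show "(\<lambda>N. ereal (1 / real N) *
           J a b \<gamma> \<alpha> (index_policy b \<gamma> \<alpha> tie) (x N) (c * real N) N) \<longlonglongrightarrow> ereal L"
      proof (rule order_tendstoI)
        fix l :: ereal assume "l < ereal L"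
        then obtain l' where l': "l < ereal l'" "l' < L" using ereal_dense2 by fastforce
        show "\<forall>\<^sub>F N in sequentially. l < ereal (1 / real N) *
          J a b \<gamma> \<alpha> (index_policy b \<gamma> \<alpha> tie) (x N) (c * real N) N"
        proof (rule eventually_mono[OF near[of "L - l'"]])
          fix N assume "\<exists>r. ereal (1 / real N) *
            J a b \<gamma> \<alpha> (index_policy b \<gamma> \<alpha> tie) (x N) (c * real N) N = ereal r \<and> \<bar>r - L\<bar> \<le> L - l'"
          then obtain r where "ereal (1 / real N) *
            J a b \<gamma> \<alpha> (index_policy b \<gamma> \<alpha> tie) (x N) (c * real N) N = ereal r" "l' \<le> r" by fastforce
          then show "l < ereal (1 / real N) * J a b \<gamma> \<alpha> (index_policy b \<gamma> \<alpha> tie) (x N) (c * real N) N"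
            using l'(1) by (simp add: less_le_trans)
        qed (use l' in simp)
      next
        fix l :: ereal assume "ereal L < l"
        then obtain l' where l': "ereal l' < l" "L < l'" using ereal_dense2 by fastforce
        show "\<forall>\<^sub>F N in sequentially. ereal (1 / real N) *
          J a b \<gamma> \<alpha> (index_policy b \<gamma> \<alpha> tie) (x N) (c * real N) N < l"
        proof (rule eventually_mono[OF near[of "l' - L"]])
          fix N assume "\<exists>r. ereal (1 / real N) *
            J a b \<gamma> \<alpha> (index_policy b \<gamma> \<alpha> tie) (x N) (c * real N) N = ereal r \<and> \<bar>r - L\<bar> \<le> l' - L"
          then obtain r where "ereal (1 / real N) *
            J a b \<gamma> \<alpha> (index_policy b \<gamma> \<alpha> tie) (x N) (c * real N) N = ereal r" "r \<le> l'" by fastforce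
          then show "ereal (1 / real N) * J a b \<gamma> \<alpha> (index_policy b \<gamma> \<alpha> tie) (x N) (c * real N) N < l"
            using l'(1) le_less_trans[of "ereal r" "ereal l'" l] by simp
        qed (use l' in simp)
      qed
    qed
  qed
qed

end
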